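(* Let $T$ be a tree of order $n$. Then $\mathcal{C}(T)=n-1$ if and only if $T\in\{K_{1,3},P_5,P_6,S(2,1)\}$.
   Context: For a graph $G$ with vertex set $V$, a set $S\subseteq V$ is a dominating set if every vertex of $V\setminus S$ is adjacent to a vertex of $S$. Two disjoint sets $V_1,V_2\subseteq V$ form a coalition in $G$ if neither is a dominating set of $G$ but $V_1\cup V_2$ is. A coalition partition of $G$ is a partition $\Psi=\{V_1,\ldots,V_k\}$ of $V$ such that every $V_i\in\Psi$ is either a dominating set of $G$ with $|V_i|=1$, or is not a dominating set and forms a coalition with some $V_j\in\Psi$. The coalition number $\mathcal{C}(G)$ is the maximum cardinality of a coalition partition of $G$. The order is $n=|V|$. For $r,s\ge 1$, the double star $S(r,s)$ is the tree with exactly two (adjacent) non-leaf vertices, one having $r$ leaf neighbors and the other $s$ leaf neighbors; $P_k$ denotes the path on $k$ vertices and $K_{1,3}$ the star with three leaves. *)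

theory Defs
  imports "Graph_Theory.Graph_Theory" "HOL-Library.Disjoint_Sets"
begin

text \<open>
  Finite simple graphs are values \<open>G\<close> of type \<open>'a pair_pre_digraph\<close> satisfying \<open>pair_graph G\<close>: finite,
  loop-free, with a symmetric set \<open>parcs G\<close> of ordered pairs as the adjacency relation.
\<close>

text \<open>
  The library predicate \<open>tree\<close> is unsuitable for symmetric digraphs, because the library counts the
  closed walk \<open>u, v, u\<close> along a single edge as a cycle. In a graph without loops and parallel edges
  the cycles in the undirected sense are the library cycles of length at least 3. Connectedness
  in the library includes that there is at least one vertex.
\<close>

definition undirected_tree :: "'a pair_pre_digraph \<Rightarrow> bool" where
  "undirected_tree G \<longleftrightarrow> pair_graph G \<and> Digraph_Component.connected (with_proj G)
     \<and> \<not> (\<exists>p. pre_digraph.cycle (with_proj G) p \<and> 3 \<le> length p)"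

definition dominating_set :: "'a pair_pre_digraph \<Rightarrow> 'a set \<Rightarrow> bool" where
  "dominating_set G S \<longleftrightarrow> S \<subseteq> pverts G \<and> (\<forall>v \<in> pverts G - S. \<exists>u \<in> S. (v, u) \<in> parcs G)"

definition coalition :: "'a pair_pre_digraph \<Rightarrow> 'a set \<Rightarrow> 'a set \<Rightarrow> bool" where
  "coalition G A B \<longleftrightarrow> A \<subseteq> pverts G \<and> B \<subseteq> pverts G \<and> A \<inter> B = {}
     \<and> \<not> dominating_set G A \<and> \<not> dominating_set G B \<and> dominating_set G (A \<union> B)"

definition coalition_partition :: "'a pair_pre_digraph \<Rightarrow> 'a set set \<Rightarrow> bool" where
  "coalition_partition G \<Psi> \<longleftrightarrow> partition_on (pverts G) \<Psi>
     \<and> (\<forall>A \<in> \<Psi>. dominating_set G A \<and> card A = 1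
                 \<or> \<not> dominating_set G A \<and> (\<exists>B \<in> \<Psi>. coalition G A B))"

definition coalition_number :: "'a pair_pre_digraph \<Rightarrow> nat" where
  "coalition_number G = Sup (card ` {\<Psi>. coalition_partition G \<Psi>})"

text \<open>The supremum is a maximum:\<close>

lemma coalition_number_eq_Max:
  assumes "finite (pverts G)" and "coalition_partition G \<Psi>"
  shows "coalition_number G = Max (card ` {\<Psi>. coalition_partition G \<Psi>})"
proof -
  have "{\<Psi>. coalition_partition G \<Psi>} \<subseteq> Pow (Pow (pverts G))"
    by (auto simp: coalition_partition_def partition_on_def)
  then have "finite {\<Psi>. coalition_partition G \<Psi>}"
    using assms(1) by (meson finite_Pow_iff finite_subset)
  then show ?thesis
    unfolding coalition_number_def using assms(2) by (intro cSup_eq_Max) auto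
qed

definition path_graph :: "nat \<Rightarrow> nat pair_pre_digraph" where
  "path_graph k = \<lparr> pverts = {..<k},
     parcs = {(i, j). i < k \<and> j < k \<and> (j = Suc i \<or> i = Suc j)} \<rparr>"

definition leaf :: "'a pair_pre_digraph \<Rightarrow> 'a \<Rightarrow> bool" where
  "leaf G x \<longleftrightarrow> x \<in> pverts G \<and> out_degree (with_proj G) x = 1"

text \<open>
  A predicate (like \<open>complete_bipartite_digraph\<close> in the library), hence closed under isomorphism;
  \<open>r\<close> and \<open>s\<close> are automatically positive, since a vertex without leaf neighbours would itself be a leaf.
\<close>

definition double_star :: "nat \<Rightarrow> nat \<Rightarrow> 'a pair_pre_digraph \<Rightarrow> bool" where
  "double_star r s G \<longleftrightarrow> undirected_tree G \<and>
     (\<exists>u v. u \<noteq> v \<and> (u, v) \<in> parcs G \<and> {x \<in> pverts G. \<not> leaf G x} = {u, v}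
        \<and> card {x. leaf G x \<and> (u, x) \<in> parcs G} = r
        \<and> card {x. leaf G x \<and> (v, x) \<in> parcs G} = s)"

end

theory Submission
  imports Defs
begin

text \<open>
  A tree without a universal vertex contains a path on four vertices, so the ends of a longest path
  are leaves \<open>l\<^sub>1, l\<^sub>2\<close> with distinct supports \<open>s\<^sub>1, s\<^sub>2\<close>. A dominating set meets both \<open>{l\<^sub>1, s\<^sub>1}\<close>
  and \<open>{l\<^sub>2, s\<^sub>2}\<close>, hence in a partition into a pair \<open>{x, y}\<close> and singletons every vertex outside
  these sets and \<open>{x, y}\<close> can only form a coalition with \<open>{x, y}\<close> itself. If there is such a
  vertex, then \<open>{x, y}\<close> is a transversal of the two sets, and a vertex not dominated by \<open>{x, y}\<close>
  is adjacent to all other vertices outside the two sets; acyclicity bounds the order by 6.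
  Order 4 gives \<open>P\<^sub>4\<close>, whose coalition number is 4. In order 6 the pair \<open>{x, y}\<close> is determined up
  to two choices by any such choice of leaves, which excludes a third leaf.
\<close>

section \<open>Partitions into nearly singletons\<close>

definition singletons :: "'a set \<Rightarrow> 'a set set" where
  "singletons A = (\<lambda>v. {v}) ` A"

lemma card_singletons: "card (singletons A) = card A"
  unfolding singletons_def by (rule card_image) (auto simp: inj_on_def)

lemma partition_on_pair_singletons:
  assumes "x \<in> A" "y \<in> A"
  shows "partition_on A (insert {x, y} (singletons (A - {x, y})))"
  using assms by (auto simp: partition_on_def singletons_def disjoint_def)

lemma card_pair_singletons:
  assumes "finite A" "x \<in> A" "y \<in> A" "x \<noteq> y"
  shows "card (insert {x, y} (singletons (A - {x, y}))) = card A - 1"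
proof -
  have "{x, y} \<notin> singletons (A - {x, y})" by (auto simp: singletons_def)
  moreover have "finite (singletons (A - {x, y}))" using assms(1) by (simp add: singletons_def)
  moreover have "card (A - {x, y}) = card A - 2"
    using assms by (subst card_Diff_subset) auto
  moreover have "card {x, y} \<le> card A" using assms by (intro card_mono) auto
  ultimately show ?thesis using assms(4) by (simp add: card_singletons)
qed

lemma partition_on_part_unique:
  assumes "partition_on A P" "B \<in> P" "C \<in> P" "z \<in> B" "z \<in> C"
  shows "B = C"
  using disjointD[OF partition_onD2[OF assms(1)] assms(2,3)] assms(4,5) by blast

text \<open>Disjointness makes any choice of one element per part injective. The elements left
  unchosen then count by how much the number of parts falls short of \<open>card A\<close>.\<close>

lemma partition_on_representatives:
  assumes "partition_on A P"
  shows "\<exists>r. inj_on r P \<and> (\<forall>B\<in>P. r B \<in> B) \<and> r ` P \<subseteq> A"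
proof -
  define r where "r = (\<lambda>B::'a set. SOME x. x \<in> B)"
  have mem: "r B \<in> B" if "B \<in> P" for B
  proof -
    have "B \<noteq> {}" using partition_onD3[OF assms] that by blast
    then show ?thesis unfolding r_def by (simp add: some_in_eq)
  qed
  have "inj_on r P"
  proof (rule inj_onI)
    fix B C assume "B \<in> P" "C \<in> P" "r B = r C"
    then show "B = C" using partition_on_part_unique[OF assms, of B C "r B"] mem[of B] mem[of C] by simp
  qed
  moreover have "r ` P \<subseteq> A" using mem partition_onD1[OF assms] by auto
  ultimately show ?thesis using mem by blast
qed

lemma partition_on_card_le:
  assumes "partition_on A P" "finite A"
  shows "card P \<le> card A"
proof -
  obtain r where "inj_on r P" "\<And>B. B \<in> P \<Longrightarrow> r B \<in> B" "r ` P \<subseteq> A"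
    using partition_on_representatives[OF assms(1)] by blast
  then show ?thesis using assms(2) card_inj_on_le by blast
qed

text \<open>Here every element is a representative. A second element of a part would represent
  another part, which would meet the first one.\<close>

lemma partition_on_card_eq:
  assumes P: "partition_on A P" "finite A" "card P = card A"
  shows "P = singletons A"
proof -
  obtain r where r: "inj_on r P" "\<And>B. B \<in> P \<Longrightarrow> r B \<in> B" "r ` P \<subseteq> A"
    using partition_on_representatives[OF P(1)] by blast
  have "card (r ` P) = card A" using card_image[OF r(1)] P(3) by simp
  then have rP: "r ` P = A" using card_subset_eq[OF P(2) r(3)] by simp
  have single: "{r B} = B" if "B \<in> P" for B
  proof -
    have "z = r B" if z: "z \<in> B" for z
    proof -
      have "z \<in> A" using z \<open>B \<in> P\<close> partition_onD1[OF P(1)] by auto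
      then obtain C where "C \<in> P" "z = r C" using rP by auto
      moreover from this have "B = C"
        using partition_on_part_unique[OF P(1) \<open>B \<in> P\<close>, of C z] r(2) z by simp
      ultimately show ?thesis by simp
    qed
    then show ?thesis using r(2)[OF that] by blast
  qed
  have "P = (\<lambda>B. {r B}) ` P" by (simp add: single)
  also have "\<dots> = singletons A" unfolding singletons_def rP[symmetric] image_image ..
  finally show ?thesis .
qed

text \<open>Exactly one element is not a representative. Its part is the pair, and every other part
  consists of its representative alone.\<close>

lemma partition_on_card_Suc_eq:
  assumes P: "partition_on A P" "finite A" "Suc (card P) = card A"
  obtains x y where "x \<in> A" "y \<in> A" "x \<noteq> y" "P = insert {x, y} (singletons (A - {x, y}))"
proof -
  obtain r where r: "inj_on r P" "\<And>B. B \<in> P \<Longrightarrow> r B \<in> B" "r ` P \<subseteq> A"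
    using partition_on_representatives[OF P(1)] by blast
  have "card (A - r ` P) = 1"
    using card_Diff_subset[of "r ` P" A] finite_subset[OF r(3) P(2)] r(3) card_image[OF r(1)] P(3)
    by simp
  then obtain y where y: "A - r ` P = {y}" by (auto simp: card_Suc_eq)
  obtain Y where Y: "Y \<in> P" "y \<in> Y" using y partition_onD1[OF P(1)] by auto
  note disj = partition_on_part_unique[OF P(1)]
  have elems: "z = r B \<or> z = y" if "B \<in> P" "z \<in> B" for B z
  proof (rule ccontr)
    assume "\<not> ?thesis"
    moreover have "z \<in> A" using that partition_onD1[OF P(1)] by auto
    ultimately obtain C where "C \<in> P" "z = r C" "z \<noteq> r B" using y by auto
    then show False using disj[of B C z] r(2) that by fastforce
  qed
  define x where "x = r Y"
  have xy: "x \<in> A" "y \<in> A" "x \<noteq> y" using y Y r(3) by (auto simp: x_def)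
  have Y_eq: "Y = {x, y}" using elems[OF Y(1)] r(2)[OF Y(1)] Y(2) by (auto simp: x_def)
  have B_eq: "B = {r B}" if "B \<in> P" "B \<noteq> Y" for B
    using elems[OF that(1)] r(2)[OF that(1)] disj[of B Y y] Y that by auto
  have "P = insert {x, y} (singletons (A - {x, y}))"
  proof (intro equalityI subsetI)
    fix B assume B: "B \<in> P"
    show "B \<in> insert {x, y} (singletons (A - {x, y}))"
    proof (cases "B = Y")
      case True
      then show ?thesis using Y_eq by simp
    next
      case False
      moreover have "r B \<noteq> x" using B Y(1) False r(1) by (auto simp: x_def inj_on_def)
      moreover have "r B \<noteq> y" using B y by auto
      moreover have "r B \<in> A" using B r(3) by auto
      ultimately show ?thesis using B_eq[OF B] by (auto simp: singletons_def)
    qed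
  next
    fix B assume "B \<in> insert {x, y} (singletons (A - {x, y}))"
    then consider "B = Y" | v where "v \<in> A" "v \<noteq> x" "v \<noteq> y" "B = {v}"
      using Y_eq by (auto simp: singletons_def)
    then show "B \<in> P"
    proof cases
      case 2
      then obtain C where C: "C \<in> P" "v = r C" using y by auto
      then have "C \<noteq> Y" using 2 by (auto simp: x_def)
      then have "C = {v}" using B_eq[OF C(1)] C(2) by simp
      then show ?thesis using C(1) 2 by simp
    qed (use Y in simp)
  qed
  then show thesis using that xy by blast
qed

section \<open>The coalition number near its trivial upper bound\<close>

lemma coalition_number_singletons:
  assumes "finite (pverts G)" "coalition_partition G (singletons (pverts G))"
  shows "coalition_number G = card (pverts G)"
  unfolding coalition_number_def
proof (rule cSup_eq_maximum)
  show "card (pverts G) \<in> card ` {\<Psi>. coalition_partition G \<Psi>}"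
    using imageI[of "singletons (pverts G)" "{\<Psi>. coalition_partition G \<Psi>}" card] assms(2)
    by (simp add: card_singletons)
next
  fix k assume "k \<in> card ` {\<Psi>. coalition_partition G \<Psi>}"
  then obtain \<Psi> where "coalition_partition G \<Psi>" "k = card \<Psi>" by blast
  then show "k \<le> card (pverts G)"
    using partition_on_card_le assms(1) unfolding coalition_partition_def by blast
qed

text \<open>Positivity ensures that a coalition partition exists, since the supremum of the empty
  set is 0. There are only finitely many, so the supremum is attained.\<close>

lemma coalition_number_attained:
  assumes "finite (pverts G)" "0 < coalition_number G"
  obtains \<Psi> where "coalition_partition G \<Psi>" "card \<Psi> = coalition_number G"
proof -
  have "{\<Psi>. coalition_partition G \<Psi>} \<noteq> {}"
  proof
    assume "{\<Psi>. coalition_partition G \<Psi>} = {}"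
    then have "coalition_number G = Sup {}" by (simp add: coalition_number_def)
    then show False using assms(2) by (simp add: Sup_nat_def)
  qed
  then obtain \<Phi> where "coalition_partition G \<Phi>" by blast
  then have max: "coalition_number G = Max (card ` {\<Psi>. coalition_partition G \<Psi>})"
    by (rule coalition_number_eq_Max[OF assms(1)])
  have "{\<Psi>. coalition_partition G \<Psi>} \<subseteq> Pow (Pow (pverts G))"
    by (auto simp: coalition_partition_def partition_on_def)
  then have "finite {\<Psi>. coalition_partition G \<Psi>}"
    using assms(1) by (meson finite_Pow_iff finite_subset)
  then have "coalition_number G \<in> card ` {\<Psi>. coalition_partition G \<Psi>}"
    unfolding max using \<open>coalition_partition G \<Phi>\<close> by (intro Max_in) blast+
  then obtain \<Psi> where "coalition_partition G \<Psi>" "coalition_number G = card \<Psi>" by blast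
  then show thesis using that by simp
qed

text \<open>By \<open>partition_on_card_eq\<close> only \<open>singletons\<close> has as many parts
  as there are vertices. Once it is ruled out, \<open>\<Psi>\<close> has maximum size.\<close>

lemma coalition_number_eq_pred:
  assumes "finite (pverts G)" "\<not> coalition_partition G (singletons (pverts G))"
    and "coalition_partition G \<Psi>" "card \<Psi> = card (pverts G) - 1"
  shows "coalition_number G = card (pverts G) - 1"
  unfolding coalition_number_def
proof (rule cSup_eq_maximum)
  show "card (pverts G) - 1 \<in> card ` {\<Psi>. coalition_partition G \<Psi>}"
    using imageI[of \<Psi> "{\<Psi>. coalition_partition G \<Psi>}" card] assms(3,4) by simp
next
  fix k assume "k \<in> card ` {\<Psi>. coalition_partition G \<Psi>}"
  then obtain \<Phi> where \<Phi>: "coalition_partition G \<Phi>" "k = card \<Phi>" by blast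
  then have part: "partition_on (pverts G) \<Phi>" by (simp add: coalition_partition_def)
  have "card \<Phi> \<noteq> card (pverts G)"
    using partition_on_card_eq[OF part assms(1)] assms(2) \<Phi>(1) by blast
  then show "k \<le> card (pverts G) - 1"
    using partition_on_card_le[OF part assms(1)] \<Phi>(2) by linarith
qed

section \<open>Paths and pendant vertices in trees\<close>

locale finite_tree =
  fixes T :: "'a pair_pre_digraph"
  assumes undirected_tree: "undirected_tree T"
begin

abbreviation V :: "'a set" where "V \<equiv> pverts T"

abbreviation adj :: "'a \<Rightarrow> 'a \<Rightarrow> bool" where "adj u v \<equiv> (u, v) \<in> parcs T"

sublocale pair_graph T
  using undirected_tree by (simp add: undirected_tree_def)

lemma adj_sym: "adj u v \<longleftrightarrow> adj v u"
  using pair_sym_arcs by (auto simp: symmetric_def sym_def)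

lemma adj_irrefl [simp]: "\<not> adj u u"
  using pair_no_loops by fastforce

lemma adj_neq: "adj u v \<Longrightarrow> u \<noteq> v"
  by auto

lemma verts_nonempty: "V \<noteq> {}"
  using undirected_tree
  by (simp add: undirected_tree_def Digraph_Component.connected_def strongly_connected_def)

text \<open>Connectedness in terms of cuts: on a walk that starts in \<open>S\<close> and ends
  outside, some arc leaves \<open>S\<close>.\<close>

lemma edge_leaving:
  assumes "S \<subseteq> V" "S \<noteq> {}" "S \<noteq> V"
  shows "\<exists>u\<in>S. \<exists>v\<in>V - S. adj u v"
proof -
  obtain a b where a: "a \<in> S" "a \<in> V" and b: "b \<in> V" "b \<notin> S" using assms by auto
  have "a \<rightarrow>\<^sup>*\<^bsub>with_proj (mk_symmetric (with_proj T))\<^esub> b"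
    using undirected_tree a b
    by (simp add: undirected_tree_def Digraph_Component.connected_def strongly_connected_def)
  \<comment> \<open>The library defines connectedness through the symmetric closure, which changes
    nothing here because the arcs are already symmetric.\<close>
  then have "a \<rightarrow>\<^sup>*\<^bsub>with_proj T\<^esub> b"
    using reachable_mk_symmetric_eq pair_sym_arcs by simp
  then show ?thesis
    using b(2)
  proof (induction rule: reachable_induct)
    case base
    then show ?case using a by simp
  next
    case (step x y)
    then show ?case using in_arcsD2 by (cases "x \<in> S") auto
  qed
qed

section \<open>Cycles as closed vertex paths\<close>

lemma pcas_vwalk_arcs: "p \<noteq> [] \<Longrightarrow> pcas (hd p) (vwalk_arcs p) (last p)"
  by (induction p rule: vwalk_arcs.induct) auto

lemma pawalk_verts_vwalk_arcs: "p \<noteq> [] \<Longrightarrow> pawalk_verts (hd p) (vwalk_arcs p) = p"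
  by (induction p rule: vwalk_arcs.induct) auto

text \<open>The arc from the last vertex back to the first turns the path into a library cycle with
  as many arcs as the path has vertices, hence at least three.\<close>

lemma no_closed_path:
  assumes "vpath p (with_proj T)" "3 \<le> length p" "adj (last p) (hd p)"
  shows False
proof -
  let ?q = "p @ [hd p]"
  have p: "p \<noteq> []" "distinct p" "set p \<subseteq> V" "set (vwalk_arcs p) \<subseteq> parcs T"
    using assms(1) by (auto simp: vpath_def vwalk_def)
  have arcs: "set (vwalk_arcs ?q) \<subseteq> parcs T"
    using set_vwalk_arcs_snoc[OF p(1)] p(4) assms(3) by auto
  have "length (vwalk_arcs ?q) = length p"
    using vwalk_length_simp[of ?q] unfolding vwalk_length_def by simp
  moreover have "cycle (vwalk_arcs ?q)"
    unfolding cycle_def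
  proof (intro exI conjI)
    show "awalk (hd p) (vwalk_arcs ?q) (hd p)"
      using pcas_vwalk_arcs[of ?q] arcs p(1,3) by (auto simp: awalk_def)
    show "distinct (tl (pawalk_verts (hd p) (vwalk_arcs ?q)))"
      using pawalk_verts_vwalk_arcs[of ?q] p(1,2) by (cases p) auto
    show "vwalk_arcs ?q \<noteq> []" using p(1) by (cases p rule: vwalk_arcs.cases) auto
  qed
  ultimately show False
    using undirected_tree assms(2) by (auto simp: undirected_tree_def)
qed

lemma no_triangle:
  assumes "adj a b" "adj b c" "adj c a"
  shows False
proof -
  have "a \<noteq> b" "b \<noteq> c" "c \<noteq> a" using assms adj_neq by blast+
  moreover have "{a, b, c} \<subseteq> V" using assms in_arcsD1 by blast
  ultimately have "vpath [a, b, c] (with_proj T)" using assms by (simp add: vpath_def vwalk_def)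
  from no_closed_path[OF this] show False using assms by simp
qed

lemma no_square:
  assumes "adj a b" "adj b c" "adj c d" "adj d a" "a \<noteq> c" "b \<noteq> d"
  shows False
proof -
  have "a \<noteq> b" "b \<noteq> c" "c \<noteq> d" "d \<noteq> a" using assms adj_neq by blast+
  moreover have "{a, b, c, d} \<subseteq> V" using assms in_arcsD1 by blast
  ultimately have "vpath [a, b, c, d] (with_proj T)" using assms by (simp add: vpath_def vwalk_def)
  from no_closed_path[OF this] show False using assms by simp
qed

section \<open>Pendant vertices and longest paths\<close>

definition pendant :: "'a \<Rightarrow> 'a \<Rightarrow> bool" where
  "pendant l s \<longleftrightarrow> (\<forall>u. adj l u \<longleftrightarrow> u = s)"

lemma pendant_adj: "pendant l s \<Longrightarrow> adj l u \<longleftrightarrow> u = s"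
  by (simp add: pendant_def)

lemma pendant_adj': "pendant l s \<Longrightarrow> adj u l \<longleftrightarrow> u = s"
  by (subst adj_sym) (rule pendant_adj)

lemma pendant_in_verts:
  assumes "pendant l s"
  shows "l \<in> V" "s \<in> V"
proof -
  have "adj l s" using assms by (simp add: pendant_adj)
  then show "l \<in> V" "s \<in> V" by (rule in_arcsD1, rule in_arcsD2)
qed

lemma vpath_Cons:
  "vpath (u # v # p) (with_proj T) \<longleftrightarrow> adj u v \<and> u \<notin> set (v # p) \<and> vpath (v # p) (with_proj T)"
  using in_arcsD1[of u v] by (auto simp: vpath_def vwalk_def)

lemma vpath_rev: "vpath p (with_proj T) \<Longrightarrow> vpath (rev p) (with_proj T)"
  using vwalk_rev_ex[OF pair_sym_arcs, of p] by (simp add: vpath_def)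

text \<open>A neighbour of \<open>l\<close> other than \<open>s\<close> would either lie on the path
  and close a cycle, or prolong the path.\<close>

lemma pendant_of_maximal_path:
  assumes path: "vpath (l # s # p) (with_proj T)"
    and max: "\<And>q. vpath q (with_proj T) \<Longrightarrow> length q \<le> length (l # s # p)"
  shows "pendant l s"
  unfolding pendant_def
proof (intro allI iffI)
  fix u assume u: "adj l u"
  show "u = s"
  proof (rule ccontr)
    assume "u \<noteq> s"
    show False
    proof (cases "u \<in> set p")
      case True
      then obtain q r where p: "p = q @ u # r" by (meson split_list)
      \<comment> \<open>Only the initial segment up to \<open>u\<close> is kept; the edge from
        \<open>u\<close> back to \<open>l\<close> closes it.\<close>
      have "vwalk ((l # s # q @ [u]) @ r) (with_proj T)"
        using path unfolding p vpath_def by simp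
      then have "vwalk (l # s # q @ [u]) (with_proj T)"
        by (rule vwalkI_append_l[rotated]) simp
      moreover have "distinct (l # s # q @ [u])"
        using path unfolding p vpath_def by auto
      ultimately have "vpath (l # s # q @ [u]) (with_proj T)" unfolding vpath_def by blast
      then show False using no_closed_path[of "l # s # q @ [u]"] u adj_sym by simp
    next
      case False
      then have "u \<notin> set (l # s # p)" using \<open>u \<noteq> s\<close> adj_neq[OF u] by simp
      then have "vpath (u # l # s # p) (with_proj T)"
        using path u adj_sym[of u l] unfolding vpath_Cons[of u] by blast
      then show False using max[of "u # l # s # p"] by simp
    qed
  qed
next
  fix u assume "u = s"
  then show "adj l u" using path unfolding vpath_Cons by blast
qed

text \<open>Among trees this excludes exactly the stars, those on one and two vertices included;
  equivalently, no single vertex dominates.\<close>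

definition no_universal_vertex :: bool where
  "no_universal_vertex \<longleftrightarrow> (\<forall>c\<in>V. \<exists>v\<in>V - {c}. \<not> adj c v)"

text \<open>An edge together with a second edge leaving it gives a vertex \<open>c\<close> with two
  neighbours. An edge out of the closed neighbourhood of \<open>c\<close> runs from a neighbour
  \<open>u\<close> to some \<open>z\<close>, and another neighbour \<open>w\<close> of
  \<open>c\<close> completes the path \<open>w, c, u, z\<close>.\<close>

lemma exists_path_of_four:
  assumes "no_universal_vertex"
  shows "\<exists>p. vpath p (with_proj T) \<and> length p = 4"
proof -
  obtain a where a: "a \<in> V" using verts_nonempty by blast
  then obtain a' where "a' \<in> V" "a' \<noteq> a" "\<not> adj a a'"
    using assms unfolding no_universal_vertex_def by blast
  then obtain b where b: "adj a b" using edge_leaving[of "{a}"] a by blast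
  have bV: "b \<in> V" "b \<noteq> a" using b in_arcsD2 adj_neq by blast+
  obtain b' where "b' \<in> V" "b' \<noteq> b" "\<not> adj b b'"
    using assms bV unfolding no_universal_vertex_def by blast
  moreover from this have "b' \<noteq> a" using adj_sym[of a b] b by auto
  ultimately have "{a, b} \<noteq> V" by blast
  then obtain x y where xy: "x \<in> {a, b}" "y \<in> V - {a, b}" "adj x y"
    using edge_leaving[of "{a, b}"] a bV by blast
  have "\<exists>c d e. adj d c \<and> adj c e \<and> d \<noteq> e"
  proof (cases "x = a")
    case True
    then have "adj b a" "adj a y" "b \<noteq> y" using xy adj_sym[of a b] b by blast+
    then show ?thesis by blast
  next
    case False
    then have "adj b y" "a \<noteq> y" using xy by blast+
    then show ?thesis using b by blast
  qed
  then obtain c d e where cde: "adj d c" "adj c e" "d \<noteq> e" by blast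
  define S where "S = insert c {u. adj c u}"
  have cV: "c \<in> V" using cde in_arcsD2 by blast
  then have "\<exists>v\<in>V - {c}. \<not> adj c v"
    using assms unfolding no_universal_vertex_def by blast
  then have "S \<noteq> V" unfolding S_def by blast
  moreover have "S \<subseteq> V" "S \<noteq> {}" using cV in_arcsD2 unfolding S_def by blast+
  ultimately obtain u z where uz: "u \<in> S" "z \<in> V - S" "adj u z" using edge_leaving by blast
  \<comment> \<open>\<open>u = c\<close> is impossible, because \<open>z\<close> would then be a
    neighbour of \<open>c\<close> and lie in \<open>S\<close>.\<close>
  then have cu: "adj c u" unfolding S_def by blast
  \<comment> \<open>\<open>w\<close> is \<open>d\<close>, or \<open>e\<close> in case
    \<open>d = u\<close>.\<close>
  obtain w where w: "adj w c" "w \<noteq> u" using cde adj_sym[of e c] by (cases "d = u") auto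
  have "z \<notin> S" using uz by blast
  then have "z \<noteq> c" "z \<noteq> w" using w adj_sym[of c w] unfolding S_def by blast+
  moreover have "w \<noteq> c" "c \<noteq> u" "u \<noteq> z" using w cu uz adj_neq by blast+
  ultimately have "vpath [w, c, u, z] (with_proj T)"
    using w cu uz in_arcsD1[OF w(1)] cV in_arcsD2[OF cu] by (simp add: vpath_def vwalk_def)
  then show ?thesis by (intro exI[of _ "[w, c, u, z]"]) simp
qed

text \<open>A longest path has at least four vertices, so its first two and its last two are
  distinct, and maximality makes both ends pendant.\<close>

lemma exists_two_pendants:
  assumes "no_universal_vertex"
  shows "\<exists>l\<^sub>1 s\<^sub>1 l\<^sub>2 s\<^sub>2. pendant l\<^sub>1 s\<^sub>1 \<and> pendant l\<^sub>2 s\<^sub>2 \<and> distinct [l\<^sub>1, s\<^sub>1, l\<^sub>2, s\<^sub>2]"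
proof -
  obtain p\<^sub>0 where p0: "vpath p\<^sub>0 (with_proj T)" "length p\<^sub>0 = 4"
    using exists_path_of_four[OF assms] by blast
  have bound: "length p < Suc (card V)" if "vpath p (with_proj T)" for p
  proof -
    have "distinct p" "set p \<subseteq> V" using that by (auto simp: vpath_def vwalk_def)
    then show ?thesis using card_mono[OF pair_finite_verts, of "set p"] distinct_card[of p] by simp
  qed
  have "\<exists>p. vpath p (with_proj T) \<and> (\<forall>q. vpath q (with_proj T) \<longrightarrow> length q \<le> length p)"
    by (rule ex_has_greatest_nat[where P = "\<lambda>p. vpath p (with_proj T)" and k = p\<^sub>0 and b = "Suc (card V)", OF p0(1)]) (intro allI impI bound)
  then obtain p where p: "vpath p (with_proj T)"
    and max: "\<And>q. vpath q (with_proj T) \<Longrightarrow> length q \<le> length p"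
    by blast
  have "4 \<le> length p" using max[OF p0(1)] p0(2) by simp
  then obtain l\<^sub>1 s\<^sub>1 q where q: "p = l\<^sub>1 # s\<^sub>1 # q" "2 \<le> length q"
    by (cases p; cases "tl p") auto
  then obtain q' l\<^sub>2 where q': "q = q' @ [l\<^sub>2]" "1 \<le> length q'"
    by (cases q rule: rev_cases) auto
  then obtain r s\<^sub>2 where "q' = r @ [s\<^sub>2]"
    by (cases q' rule: rev_cases) auto
  with q q' have p_eq: "p = l\<^sub>1 # s\<^sub>1 # r @ [s\<^sub>2, l\<^sub>2]" by simp
  have "pendant l\<^sub>1 s\<^sub>1"
    by (rule pendant_of_maximal_path[OF p[unfolded p_eq] max[unfolded p_eq]])
  moreover have "pendant l\<^sub>2 s\<^sub>2"
  proof (rule pendant_of_maximal_path)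
    show "vpath (l\<^sub>2 # s\<^sub>2 # rev (l\<^sub>1 # s\<^sub>1 # r)) (with_proj T)"
      using vpath_rev[OF p] unfolding p_eq by (simp only: rev.simps rev_append append.simps append_assoc)
    show "length q \<le> length (l\<^sub>2 # s\<^sub>2 # rev (l\<^sub>1 # s\<^sub>1 # r))" if "vpath q (with_proj T)" for q
      using max[OF that] unfolding p_eq by simp
  qed
  moreover have "distinct p"
    using p unfolding vpath_def by blast
  then have "distinct [l\<^sub>1, s\<^sub>1, l\<^sub>2, s\<^sub>2]"
    unfolding p_eq by auto
  ultimately show ?thesis
    by (intro exI[of _ l\<^sub>1] exI[of _ s\<^sub>1] exI[of _ l\<^sub>2] exI[of _ s\<^sub>2] conjI)
qed

section \<open>Partitions with one pair in a tree with two supports\<close>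

abbreviation dominating :: "'a set \<Rightarrow> bool" where
  "dominating \<equiv> dominating_set T"

lemma dominatingD: "dominating S \<Longrightarrow> v \<in> V \<Longrightarrow> v \<notin> S \<Longrightarrow> \<exists>u\<in>S. adj v u"
  by (simp add: dominating_set_def)

text \<open>The closed neighbourhood of \<open>l\<close> is \<open>{l, s}\<close>.\<close>

lemma dominating_pendant:
  assumes "dominating S" "pendant l s"
  shows "l \<in> S \<or> s \<in> S"
  using dominatingD[OF assms(1) pendant_in_verts(1)[OF assms(2)]] pendant_adj[OF assms(2)] by auto

lemma not_dominating_singleton:
  assumes "no_universal_vertex"
  shows "\<not> dominating {v}"
proof
  assume dom: "dominating {v}"
  then have "v \<in> V" by (simp add: dominating_set_def)
  then obtain u where u: "u \<in> V" "u \<noteq> v" "\<not> adj v u"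
    using assms unfolding no_universal_vertex_def by blast
  then show False using dominatingD[OF dom u(1)] adj_sym[of u v] by simp
qed

text \<open>Distinctness makes the closed neighbourhoods of the two leaves disjoint. Every
  dominating set meets both, so one with two elements has one element in each.\<close>

definition two_pendants :: "'a \<Rightarrow> 'a \<Rightarrow> 'a \<Rightarrow> 'a \<Rightarrow> bool" where
  "two_pendants l\<^sub>1 s\<^sub>1 l\<^sub>2 s\<^sub>2 \<longleftrightarrow>
     pendant l\<^sub>1 s\<^sub>1 \<and> pendant l\<^sub>2 s\<^sub>2 \<and> distinct [l\<^sub>1, s\<^sub>1, l\<^sub>2, s\<^sub>2]"

lemma two_pendants_commute: "two_pendants l\<^sub>1 s\<^sub>1 l\<^sub>2 s\<^sub>2 \<Longrightarrow> two_pendants l\<^sub>2 s\<^sub>2 l\<^sub>1 s\<^sub>1"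
  by (auto simp: two_pendants_def)

lemma two_pendants_verts: "two_pendants l\<^sub>1 s\<^sub>1 l\<^sub>2 s\<^sub>2 \<Longrightarrow> {l\<^sub>1, s\<^sub>1, l\<^sub>2, s\<^sub>2} \<subseteq> V"
  using pendant_in_verts[of l\<^sub>1 s\<^sub>1] pendant_in_verts[of l\<^sub>2 s\<^sub>2] by (simp add: two_pendants_def)

lemma card_outside_two_pendants:
  assumes "two_pendants l\<^sub>1 s\<^sub>1 l\<^sub>2 s\<^sub>2"
  shows "card V = card (V - {l\<^sub>1, s\<^sub>1, l\<^sub>2, s\<^sub>2}) + 4"
proof -
  have "card {l\<^sub>1, s\<^sub>1, l\<^sub>2, s\<^sub>2} = 4" using assms by (simp add: two_pendants_def)
  then show ?thesis
    using card_Diff_subset[OF _ two_pendants_verts[OF assms]]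
      card_mono[OF pair_finite_verts two_pendants_verts[OF assms]] by simp
qed

text \<open>The single vertex of a partner of \<open>{v}\<close> would have to lie in both of two
  disjoint sets, since \<open>v\<close> is in neither.\<close>

lemma singletons_not_coalition_partition:
  assumes P: "two_pendants l\<^sub>1 s\<^sub>1 l\<^sub>2 s\<^sub>2" and v: "v \<in> V - {l\<^sub>1, s\<^sub>1, l\<^sub>2, s\<^sub>2}"
  shows "\<not> coalition_partition T (singletons V)"
proof
  assume "coalition_partition T (singletons V)"
  moreover have "{v} \<in> singletons V" using v by (simp add: singletons_def)
  moreover have "\<not> dominating {v}"
    using dominating_pendant[of "{v}" l\<^sub>1 s\<^sub>1] P v unfolding two_pendants_def by auto
  ultimately obtain B where "B \<in> singletons V" "coalition T {v} B"
    unfolding coalition_partition_def by blast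
  then obtain w where "dominating {v, w}"
    unfolding singletons_def coalition_def by auto
  then show False
    using dominating_pendant[of "{v, w}" l\<^sub>1 s\<^sub>1] dominating_pendant[of "{v, w}" l\<^sub>2 s\<^sub>2] P v
    unfolding two_pendants_def by auto
qed

text \<open>What a coalition partition into \<open>{x, y}\<close> and singletons imposes on vertices
  when no singleton dominates: the partner of \<open>{v}\<close> is either another singleton or the
  pair.\<close>

definition coalition_pair :: "'a \<Rightarrow> 'a \<Rightarrow> bool" where
  "coalition_pair x y \<longleftrightarrow> \<not> dominating {x, y} \<and>
     (\<forall>v\<in>V - {x, y}. (\<exists>w\<in>V - {x, y}. dominating {v, w}) \<or> dominating {v, x, y})"

lemma coalition_pairI:
  assumes part: "coalition_partition T (insert {x, y} (singletons (V - {x, y})))"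
    and "x \<noteq> y" "no_universal_vertex"
  shows "coalition_pair x y"
  unfolding coalition_pair_def
proof (intro conjI ballI)
  show "\<not> dominating {x, y}"
    using part \<open>x \<noteq> y\<close> unfolding coalition_partition_def by auto
next
  fix v assume v: "v \<in> V - {x, y}"
  then have "{v} \<in> insert {x, y} (singletons (V - {x, y}))" by (simp add: singletons_def)
  then obtain B where "B \<in> insert {x, y} (singletons (V - {x, y}))" "coalition T {v} B"
    using part not_dominating_singleton[OF assms(3)] unfolding coalition_partition_def by blast
  then show "(\<exists>w\<in>V - {x, y}. dominating {v, w}) \<or> dominating {v, x, y}"
    unfolding singletons_def coalition_def by auto
qed

lemma coalition_pair_commute: "coalition_pair x y \<Longrightarrow> coalition_pair y x"
  by (simp add: coalition_pair_def insert_commute)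

lemma coalition_pair_undominated:
  assumes "coalition_pair x y" "x \<in> V" "y \<in> V"
  obtains u where "u \<in> V" "u \<noteq> x" "u \<noteq> y" "\<not> adj u x" "\<not> adj u y"
  using assms unfolding coalition_pair_def dominating_set_def by auto

text \<open>A singleton partner of \<open>{v}\<close> cannot meet both closed neighbourhoods, so the
  partner is the pair.\<close>

lemma coalition_pair_outside:
  assumes P: "two_pendants l\<^sub>1 s\<^sub>1 l\<^sub>2 s\<^sub>2" and pair: "coalition_pair x y"
    and v: "v \<in> V - {l\<^sub>1, s\<^sub>1, l\<^sub>2, s\<^sub>2} - {x, y}"
  shows "dominating {v, x, y}"
proof (rule ccontr)
  assume "\<not> dominating {v, x, y}"
  then obtain w where "dominating {v, w}" using pair v unfolding coalition_pair_def by blast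
  then show False
    using dominating_pendant[of "{v, w}" l\<^sub>1 s\<^sub>1] dominating_pendant[of "{v, w}" l\<^sub>2 s\<^sub>2] P v
    unfolding two_pendants_def by auto
qed

text \<open>A vertex \<open>u\<close> not dominated by the supports is neither of the two leaves nor
  adjacent to one. Then \<open>{l\<^sub>1}\<close> has no partner: a singleton partner must be
  \<open>{l\<^sub>2}\<close>, which leaves \<open>u\<close> undominated, and so does the
  pair.\<close>

lemma coalition_pair_supports:
  assumes P: "two_pendants l\<^sub>1 s\<^sub>1 l\<^sub>2 s\<^sub>2" and pair: "coalition_pair s\<^sub>1 s\<^sub>2"
  shows False
proof -
  have p: "pendant l\<^sub>1 s\<^sub>1" "pendant l\<^sub>2 s\<^sub>2" and d: "distinct [l\<^sub>1, s\<^sub>1, l\<^sub>2, s\<^sub>2]"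
    using P unfolding two_pendants_def by blast+
  have V: "l\<^sub>1 \<in> V" "s\<^sub>1 \<in> V" "s\<^sub>2 \<in> V" using two_pendants_verts[OF P] by blast+
  obtain u where u: "u \<in> V" "u \<noteq> s\<^sub>1" "u \<noteq> s\<^sub>2" "\<not> adj u s\<^sub>1" "\<not> adj u s\<^sub>2"
    by (rule coalition_pair_undominated[OF pair V(2,3)])
  have ul: "u \<noteq> l\<^sub>1" "u \<noteq> l\<^sub>2" "\<not> adj u l\<^sub>1" "\<not> adj u l\<^sub>2"
    using u p pendant_adj pendant_adj' by blast+
  have "l\<^sub>1 \<in> V - {s\<^sub>1, s\<^sub>2}" using V d by simp
  then consider w where "w \<notin> {s\<^sub>1, s\<^sub>2}" "dominating {l\<^sub>1, w}" | "dominating {l\<^sub>1, s\<^sub>1, s\<^sub>2}"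
    using pair unfolding coalition_pair_def by blast
  then show False
  proof cases
    case 1
    then have "w = l\<^sub>2" using dominating_pendant[OF 1(2) p(2)] d by auto
    then show False using dominatingD[OF 1(2) u(1)] ul by simp
  next
    case 2
    then show False using dominatingD[OF 2 u(1)] ul u by simp
  qed
qed

text \<open>The undominated vertex \<open>u\<close> excludes the pair as partner of
  \<open>{l\<^sub>2}\<close>, so this partner is \<open>{s\<^sub>1}\<close>, and all vertices
  outside the four are adjacent to \<open>s\<^sub>1\<close>. A second outside vertex would have to
  dominate \<open>u\<close> and so create a triangle.\<close>

lemma coalition_pair_leaf_support:
  assumes P: "two_pendants l\<^sub>1 s\<^sub>1 l\<^sub>2 s\<^sub>2" and pair: "coalition_pair l\<^sub>1 s\<^sub>2"
  shows "card V = 5"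
proof -
  have p: "pendant l\<^sub>1 s\<^sub>1" "pendant l\<^sub>2 s\<^sub>2" and d: "distinct [l\<^sub>1, s\<^sub>1, l\<^sub>2, s\<^sub>2]"
    using P unfolding two_pendants_def by blast+
  have V: "l\<^sub>1 \<in> V" "s\<^sub>1 \<in> V" "s\<^sub>2 \<in> V" "l\<^sub>2 \<in> V" using two_pendants_verts[OF P] by blast+
  let ?Q = "{l\<^sub>1, s\<^sub>1, l\<^sub>2, s\<^sub>2}"
  obtain u where u: "u \<in> V" "u \<noteq> l\<^sub>1" "u \<noteq> s\<^sub>2" "\<not> adj u l\<^sub>1" "\<not> adj u s\<^sub>2"
    by (rule coalition_pair_undominated[OF pair V(1,3)])
  have us: "u \<noteq> s\<^sub>1" using u pendant_adj'[OF p(1)] by simp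
  have ul: "u \<noteq> l\<^sub>2" "\<not> adj u l\<^sub>2" using u pendant_adj[OF p(2)] pendant_adj'[OF p(2)] by blast+
  have "l\<^sub>2 \<in> V - {l\<^sub>1, s\<^sub>2}" using V d by auto
  then consider w where "w \<notin> {l\<^sub>1, s\<^sub>2}" "dominating {l\<^sub>2, w}" | "dominating {l\<^sub>2, l\<^sub>1, s\<^sub>2}"
    using pair unfolding coalition_pair_def by blast
  then have dom: "dominating {l\<^sub>2, s\<^sub>1}"
  proof cases
    case 1
    then have "w = s\<^sub>1" using dominating_pendant[OF 1(2) p(1)] d by auto
    then show ?thesis using 1 by simp
  next
    case 2
    then show ?thesis using dominatingD[OF 2 u(1)] ul u by simp
  qed
  have near: "adj v s\<^sub>1" if "v \<in> V - ?Q" for v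
  proof -
    have "v \<in> V" "v \<notin> {l\<^sub>2, s\<^sub>1}" "\<not> adj v l\<^sub>2" using that pendant_adj'[OF p(2)] by simp_all
    then show ?thesis using dominatingD[OF dom, of v] by simp
  qed
  have uQ: "u \<in> V - ?Q" using u us ul by simp
  have "v = u" if v: "v \<in> V - ?Q" for v
  proof (rule ccontr)
    assume "v \<noteq> u"
    have "dominating {v, l\<^sub>1, s\<^sub>2}" using coalition_pair_outside[OF P pair] v by simp
    then have "adj u v" using dominatingD[of "{v, l\<^sub>1, s\<^sub>2}" u] u \<open>v \<noteq> u\<close> by simp
    then show False using no_triangle[of u v s\<^sub>1] near[OF v] near[OF uQ] adj_sym[of u s\<^sub>1] by simp
  qed
  then have "V - ?Q = {u}" using uQ by blast
  then show ?thesis using card_outside_two_pendants[OF P] by simp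
qed

text \<open>Outside vertices are not adjacent to the leaves, so each of them must dominate all the
  others. They are pairwise adjacent, and three of them would form a triangle.\<close>

lemma coalition_pair_leaves:
  assumes P: "two_pendants l\<^sub>1 s\<^sub>1 l\<^sub>2 s\<^sub>2" and pair: "coalition_pair l\<^sub>1 l\<^sub>2"
  shows "card V \<le> 6"
proof (rule ccontr)
  assume large: "\<not> card V \<le> 6"
  have p: "pendant l\<^sub>1 s\<^sub>1" "pendant l\<^sub>2 s\<^sub>2"
    using P unfolding two_pendants_def by blast+
  let ?Q = "{l\<^sub>1, s\<^sub>1, l\<^sub>2, s\<^sub>2}"
  have adj: "adj u v" if "u \<in> V - ?Q" "v \<in> V - ?Q" "u \<noteq> v" for u v
  proof -
    have "dominating {v, l\<^sub>1, l\<^sub>2}" using coalition_pair_outside[OF P pair] that by simp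
    then show ?thesis
      using dominatingD[of "{v, l\<^sub>1, l\<^sub>2}" u] that pendant_adj'[OF p(1)] pendant_adj'[OF p(2)] by simp
  qed
  have "3 \<le> card (V - ?Q)" using card_outside_two_pendants[OF P] large by simp
  then obtain S where "S \<subseteq> V - ?Q" "card S = 3" using obtain_subset_with_card_n by metis
  then obtain a b c where "{a, b, c} \<subseteq> V - ?Q" "a \<noteq> b" "b \<noteq> c" "c \<noteq> a"
    unfolding card_3_iff by auto
  then show False using no_triangle[of a b c] adj[of a b] adj[of b c] adj[of c a] by simp
qed

text \<open>Either the pair contains all vertices outside the four, which are then at most two, or
  some outside vertex has the pair as partner. In the second case the pair takes one element from
  each closed neighbourhood, and the three preceding lemmas cover all combinations.\<close>

lemma coalition_pair_card:
  assumes P: "two_pendants l\<^sub>1 s\<^sub>1 l\<^sub>2 s\<^sub>2" and pair: "coalition_pair x y"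
    and xy: "x \<in> V" "y \<in> V"
  shows "card V \<le> 6"
    and "card V = 6 \<Longrightarrow> {x, y} = V - {l\<^sub>1, s\<^sub>1, l\<^sub>2, s\<^sub>2} \<or> {x, y} = {l\<^sub>1, l\<^sub>2}"
proof -
  let ?Q = "{l\<^sub>1, s\<^sub>1, l\<^sub>2, s\<^sub>2}"
  \<comment> \<open>Two supports are impossible, a leaf with the opposite support forces order 5,
    and two leaves allow order at most 6.\<close>
  have transversal: "card V = 5 \<or> {a, b} = {l\<^sub>1, l\<^sub>2} \<and> card V \<le> 6"
    if "coalition_pair a b" "a \<in> {l\<^sub>1, s\<^sub>1}" "b \<in> {l\<^sub>2, s\<^sub>2}" for a b
    using that coalition_pair_supports[OF P] coalition_pair_leaf_support[OF P]
      coalition_pair_leaf_support[OF two_pendants_commute[OF P] coalition_pair_commute]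
      coalition_pair_leaves[OF P] by auto
  have "card V \<le> 6 \<and> (card V = 6 \<longrightarrow> {x, y} = V - ?Q \<or> {x, y} = {l\<^sub>1, l\<^sub>2})"
  proof (cases "V - ?Q \<subseteq> {x, y}")
    case True
    have "card {x, y} \<le> 2" by (simp add: card_insert_if)
    moreover have "card (V - ?Q) \<le> card {x, y}" using True by (intro card_mono) simp_all
    moreover have "V - ?Q = {x, y}" if "card {x, y} \<le> card (V - ?Q)"
      using True that by (intro card_seteq) simp_all
    ultimately show ?thesis using card_outside_two_pendants[OF P] by auto
  next
    case False
    then obtain v where v: "v \<in> V - ?Q - {x, y}" by blast
    have dom: "dominating {v, x, y}" by (rule coalition_pair_outside[OF P pair v])
    have "l\<^sub>1 \<in> {x, y} \<or> s\<^sub>1 \<in> {x, y}" "l\<^sub>2 \<in> {x, y} \<or> s\<^sub>2 \<in> {x, y}" "distinct [l\<^sub>1, s\<^sub>1, l\<^sub>2, s\<^sub>2]"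
      using dominating_pendant[OF dom] v P unfolding two_pendants_def by blast+
    then have "x \<in> {l\<^sub>1, s\<^sub>1} \<and> y \<in> {l\<^sub>2, s\<^sub>2} \<or> y \<in> {l\<^sub>1, s\<^sub>1} \<and> x \<in> {l\<^sub>2, s\<^sub>2}"
      by auto
    then show ?thesis
      using transversal[OF pair] transversal[OF coalition_pair_commute[OF pair]]
      by (auto simp: insert_commute)
  qed
  then show "card V \<le> 6" and "card V = 6 \<Longrightarrow> {x, y} = V - ?Q \<or> {x, y} = {l\<^sub>1, l\<^sub>2}"
    by blast+
qed

section \<open>Stars\<close>

lemma adj_symD: "adj u v \<Longrightarrow> adj v u"
  by (subst adj_sym)

text \<open>The bound on the order makes the coalition number positive, hence attained by a
  partition with one part fewer than vertices.\<close>

lemma coalition_partition_exists: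
  assumes "coalition_number T = card V - 1" "2 \<le> card V"
  shows "\<exists>x\<in>V. \<exists>y\<in>V. x \<noteq> y \<and> coalition_partition T (insert {x, y} (singletons (V - {x, y})))"
proof -
  obtain \<Psi> where \<Psi>: "coalition_partition T \<Psi>" "card \<Psi> = coalition_number T"
    by (rule coalition_number_attained[OF pair_finite_verts]) (use assms in simp)
  have part: "partition_on V \<Psi>" using \<Psi>(1) by (simp add: coalition_partition_def)
  obtain x y where "x \<in> V" "y \<in> V" "x \<noteq> y" "\<Psi> = insert {x, y} (singletons (V - {x, y}))"
    by (rule partition_on_card_Suc_eq[OF part pair_finite_verts]) (use assms \<Psi>(2) in simp)
  then show ?thesis using \<Psi>(1) by blast
qed

lemma partition_on_singletons: "partition_on A (singletons A)"
  by (auto simp: partition_on_def singletons_def disjoint_def)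

lemma coalition_singletonI:
  assumes "u \<in> V" "v \<in> V" "u \<noteq> v"
    and "\<not> dominating {u}" "\<not> dominating {v}" "dominating {u, v}"
  shows "coalition T {u} {v}"
  using assms by (simp add: coalition_def insert_commute)

text \<open>The tree is a star with centre \<open>c\<close>, and only order 4 survives. Up to order
  3 the singletons form a coalition partition. From order 5 on, a leaf outside the pair has no
  partner, because a dominating set that avoids \<open>c\<close> contains all leaves.\<close>

lemma star_of_universal_vertex:
  assumes c: "c \<in> V" "\<And>v. v \<in> V - {c} \<Longrightarrow> adj c v"
    and number: "coalition_number T = card V - 1"
  shows "complete_bipartite_digraph 1 3 (with_proj T)"
proof -
  have leaf: "pendant a c" if "a \<in> V - {c}" for a
    unfolding pendant_def
  proof (intro allI iffI)
    fix u assume u: "adj a u"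
    show "u = c"
    proof (rule ccontr)
      assume "u \<noteq> c"
      then have "adj c u" using c(2) in_arcsD2[OF u] by simp
      then show False using no_triangle[of c a u] u c(2)[OF that] adj_sym[of u c] by simp
    qed
  next
    fix u assume "u = c"
    then show "adj a u" using adj_symD[OF c(2)[OF that]] by simp
  qed
  have dom_c: "dominating {c}"
    using c pendant_adj[OF leaf] by (simp add: dominating_set_def)
  have "\<not> card V \<le> 3"
  proof
    assume small: "card V \<le> 3"
    have "card {v} = 1 \<and> dominating {v} \<or> \<not> dominating {v} \<and> (\<exists>B\<in>singletons V. coalition T {v} B)"
      if v: "v \<in> V" for v
    proof (cases "dominating {v}")
      case False
      then have "v \<noteq> c" using dom_c by blast
      obtain u where u: "u \<in> V" "u \<noteq> v" "\<not> adj u v"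
        using False v by (auto simp: dominating_set_def)
      then have "u \<noteq> c" using c(2)[of v] v \<open>v \<noteq> c\<close> by blast
      \<comment> \<open>A non-dominating singleton forces two leaves \<open>v\<close> and
        \<open>u\<close>; with the centre they exhaust the vertices, so the leaves together
        dominate.\<close>
      have "V = {c, v, u}"
        using small c(1) v u(1,2) \<open>v \<noteq> c\<close> \<open>u \<noteq> c\<close> pair_finite_verts
        by (intro card_seteq[symmetric]) auto
      then have "dominating {v, u}"
        using c(2)[of v] v \<open>v \<noteq> c\<close> by (auto simp: dominating_set_def)
      moreover have "\<not> dominating {u}"
        using dominatingD[of "{u}" v] v u adj_sym[of u v] by auto
      ultimately have "coalition T {v} {u}"
        using coalition_singletonI v u False by simp
      then show ?thesis using False u(1) by (auto simp: singletons_def)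
    qed simp
    then have "coalition_partition T (singletons V)"
      unfolding coalition_partition_def using partition_on_singletons
      by (auto simp: singletons_def)
    \<comment> \<open>With truncated subtraction this equation holds only for 0, but
      \<open>c\<close> is a vertex.\<close>
    then have "card V - 1 = card V"
      using coalition_number_singletons[OF pair_finite_verts] number by simp
    then show False using c(1) pair_finite_verts card_gt_0_iff[of V] by auto
  qed
  moreover have "\<not> 5 \<le> card V"
  proof
    assume large: "5 \<le> card V"
    obtain x y where xy: "x \<in> V" "y \<in> V" "x \<noteq> y"
      and part: "coalition_partition T (insert {x, y} (singletons (V - {x, y})))"
      using coalition_partition_exists[OF number] large by fastforce
    have "\<not> dominating {x, y}"
      using part \<open>x \<noteq> y\<close> unfolding coalition_partition_def by auto
    then have xyc: "x \<noteq> c" "y \<noteq> c"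
      using dom_c xy by (auto simp: dominating_set_def)
    have "card {c, x, y} \<le> 3" by (simp add: card_insert_if)
    then have "2 \<le> card (V - {c, x, y})"
      using large diff_card_le_card_Diff[of "{c, x, y}" V] by simp
    then obtain S where "S \<subseteq> V - {c, x, y}" "card S = 2" by (rule obtain_subset_with_card_n)
    then obtain a b where ab: "a \<in> V - {c, x, y}" "b \<in> V - {c, x, y}" "a \<noteq> b"
      unfolding card_2_iff by auto
    have "\<not> dominating {a}"
      using dominating_pendant[of "{a}" x c] leaf[of x] xy xyc ab by auto
    moreover have "{a} \<in> insert {x, y} (singletons (V - {x, y}))"
      using ab by (simp add: singletons_def)
    ultimately obtain B where "B \<in> insert {x, y} (singletons (V - {x, y}))" "coalition T {a} B"
      using part unfolding coalition_partition_def by blast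
    \<comment> \<open>A singleton partner is not \<open>{c}\<close>, since \<open>{c}\<close>
      dominates on its own. In the first case the leaf \<open>b\<close> is missed, in the second the
      leaf \<open>x\<close>.\<close>
    then consider "dominating {a, x, y}" | w where "w \<notin> {x, y}" "w \<noteq> c" "dominating {a, w}"
      using dom_c unfolding singletons_def coalition_def by auto
    then show False
    proof cases
      case 1
      then show False using dominating_pendant[of _ b c] leaf[of b] xyc ab by auto
    next
      case 2
      then show False using dominating_pendant[of _ x c] leaf[of x] xy xyc ab by auto
    qed
  qed
  ultimately have "card V = 4" by simp
  then have "card (V - {c}) = 3" using c(1) pair_finite_verts by simp
  moreover have "parcs T = {c} \<times> (V - {c}) \<union> (V - {c}) \<times> {c}"
  proof (intro equalityI subrelI)
    fix u v assume uv: "adj u v"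
    have "u = c \<or> v = c" using leaf[of u] pendant_adj[of u c v] in_arcsD1[OF uv] uv by blast
    then show "(u, v) \<in> {c} \<times> (V - {c}) \<union> (V - {c}) \<times> {c}"
      using in_arcsD1[OF uv] in_arcsD2[OF uv] adj_neq[OF uv] by auto
  next
    fix u v assume "(u, v) \<in> {c} \<times> (V - {c}) \<union> (V - {c}) \<times> {c}"
    then show "adj u v" using c(2)[of v] adj_symD[OF c(2), of u] by auto
  qed
  moreover have "V = {c} \<union> (V - {c})" using c(1) by blast
  ultimately show ?thesis
    unfolding complete_bipartite_digraph_pair_def
    using pair_finite_verts by (intro conjI exI[of _ "{c}"] exI[of _ "V - {c}"]) simp_all
qed

text \<open>The two leaves dominate together, and so do the two supports. The four singletons
  therefore form a coalition partition.\<close>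

lemma coalition_number_order_four:
  assumes P: "two_pendants l\<^sub>1 s\<^sub>1 l\<^sub>2 s\<^sub>2" and "card V = 4" "no_universal_vertex"
  shows "coalition_number T = card V"
proof -
  have p: "pendant l\<^sub>1 s\<^sub>1" "pendant l\<^sub>2 s\<^sub>2" and d: "distinct [l\<^sub>1, s\<^sub>1, l\<^sub>2, s\<^sub>2]"
    using P unfolding two_pendants_def by blast+
  have V: "V = {l\<^sub>1, s\<^sub>1, l\<^sub>2, s\<^sub>2}"
    using card_outside_two_pendants[OF P] assms(2) pair_finite_verts two_pendants_verts[OF P] by auto
  have "dominating {l\<^sub>1, l\<^sub>2}" "dominating {s\<^sub>1, s\<^sub>2}"
    unfolding dominating_set_def V using pendant_adj[OF p(1)] pendant_adj[OF p(2)]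
      pendant_adj'[OF p(1)] pendant_adj'[OF p(2)] by auto
  then have "coalition T {l\<^sub>1} {l\<^sub>2}" "coalition T {l\<^sub>2} {l\<^sub>1}"
    "coalition T {s\<^sub>1} {s\<^sub>2}" "coalition T {s\<^sub>2} {s\<^sub>1}"
    using d V not_dominating_singleton[OF assms(3)]
    by (auto intro!: coalition_singletonI simp: insert_commute)
  then have "coalition_partition T (singletons V)"
    using partition_on_singletons[of V] not_dominating_singleton[OF assms(3)]
    unfolding coalition_partition_def by (auto simp: singletons_def V)
  then show ?thesis by (rule coalition_number_singletons[OF pair_finite_verts])
qed

section \<open>Spanning paths and isomorphism to path graphs\<close>

lemma set_vwalk_arcs_nth: "set (vwalk_arcs p) = {(p ! i, p ! Suc i) | i. Suc i < length p}"
proof (induction p rule: vwalk_arcs.induct)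
  case (3 x y p)
  have "{(q ! i, q ! Suc i) | i. Suc i < length q} =
      insert (x, y) {((y # p) ! i, (y # p) ! Suc i) | i. Suc i < length (y # p)}" (is "?A = insert _ ?B")
    if "q = x # y # p" for q
  proof (intro equalityI subsetI)
    fix e assume "e \<in> ?A"
    then obtain i where "e = (q ! i, q ! Suc i)" "Suc i < length q" by blast
    then show "e \<in> insert (x, y) ?B" unfolding that by (cases i) auto
  next
    fix e assume "e \<in> insert (x, y) ?B"
    then consider "e = (x, y)" | i where "e = ((y # p) ! i, (y # p) ! Suc i)" "Suc i < length (y # p)"
      by blast
    then show "e \<in> ?A"
    proof cases
      case 1
      then show ?thesis unfolding that by (intro CollectI exI[of _ 0]) simp
    next
      case (2 i)
      then show ?thesis unfolding that by (intro CollectI exI[of _ "Suc i"]) simp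
    qed
  qed
  then show ?case using 3 by simp
qed auto

lemma vpath_nth: "vpath p (with_proj T) \<longleftrightarrow>
    p \<noteq> [] \<and> distinct p \<and> set p \<subseteq> V \<and> (\<forall>i. Suc i < length p \<longrightarrow> adj (p ! i) (p ! Suc i))"
  unfolding vpath_def vwalk_def set_vwalk_arcs_nth by auto

lemma spanning_vpathI:
  assumes "p \<noteq> []" "distinct p" "set p = V" "set (vwalk_arcs p) \<subseteq> parcs T"
  shows "vpath p (with_proj T)"
  using assms by (simp add: vpath_def vwalk_def)

text \<open>Paths in a tree have no chords: a chord would close the segment between its ends into a
  cycle.\<close>

lemma vpath_adj_nth:
  assumes p: "vpath p (with_proj T)" and ij: "i < j" "j < length p" "adj (p ! i) (p ! j)"
  shows "j = Suc i"
proof (rule ccontr)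
  assume "j \<noteq> Suc i"
  let ?q = "drop i (take (Suc j) p)"
  have len: "length ?q = Suc j - i" using ij by simp
  have nth: "?q ! k = p ! (i + k)" if "k < Suc j - i" for k using that ij by simp
  have path: "vpath ?q (with_proj T)"
    unfolding vpath_nth
  proof (intro conjI allI impI)
    show "distinct ?q" "set ?q \<subseteq> V"
      using p set_drop_subset[of i "take (Suc j) p"] set_take_subset[of "Suc j" p]
      unfolding vpath_nth by auto
    show "?q \<noteq> []" using len ij by auto
    fix k assume "Suc k < length ?q"
    then show "adj (?q ! k) (?q ! Suc k)" using p ij unfolding vpath_nth by simp
  qed
  have "?q \<noteq> []" using len ij by auto
  then have "last ?q = p ! j" "hd ?q = p ! i"
    using nth[of "j - i"] nth[of 0] len ij by (simp_all add: last_conv_nth hd_conv_nth)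
  then have closed: "adj (last ?q) (hd ?q)" using adj_symD[OF ij(3)] by simp
  have "3 \<le> length ?q" using len ij \<open>j \<noteq> Suc i\<close> by simp
  then show False by (rule no_closed_path[OF path _ closed])
qed

text \<open>The isomorphism sends each vertex to its position on the spanning path. Since the path
  has no chords, adjacent vertices have consecutive positions.\<close>

lemma digraph_iso_path_graphI:
  assumes p: "vpath p (with_proj T)" "set p = V"
  shows "digraph_iso (with_proj T) (with_proj (path_graph (length p)))"
proof -
  let ?n = "length p"
  have dist: "distinct p" and steps: "\<And>i. Suc i < ?n \<Longrightarrow> adj (p ! i) (p ! Suc i)"
    using p(1) unfolding vpath_nth by blast+
  define g where "g = the_inv_into {..<?n} ((!) p)"
  have bij: "bij_betw ((!) p) {..<?n} V" using bij_betw_nth[OF dist] p(2) by simp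
  then have inj: "inj_on ((!) p) {..<?n}" by (rule bij_betw_imp_inj_on)
  have g_nth: "g (p ! i) = i" if "i < ?n" for i
    unfolding g_def using the_inv_into_f_f[OF inj] that by simp
  have bij_g: "bij_betw g V {..<?n}" unfolding g_def by (rule bij_betw_the_inv_into[OF bij])
  have nth_g: "g v < ?n" "p ! g v = v" if "v \<in> V" for v
    using that bij_betwE[OF bij_g] f_the_inv_into_f_bij_betw[OF bij] unfolding g_def by auto
  have parcs: "parcs (path_graph ?n) = (\<lambda>(u, v). (g u, g v)) ` parcs T"
  proof (intro equalityI subsetI)
    fix e assume "e \<in> parcs (path_graph ?n)"
    then obtain i j where e: "e = (i, j)" "i < ?n" "j < ?n" "j = Suc i \<or> i = Suc j"
      unfolding path_graph_def by auto
    then have "adj (p ! i) (p ! j)" using steps[of i] adj_symD[OF steps[of j]] by auto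
    then show "e \<in> (\<lambda>(u, v). (g u, g v)) ` parcs T"
      using e g_nth by (intro image_eqI[of _ _ "(p ! i, p ! j)"]) simp_all
  next
    fix e assume "e \<in> (\<lambda>(u, v). (g u, g v)) ` parcs T"
    then obtain u v where e: "e = (g u, g v)" and uv: "adj u v" by auto
    have lt: "g u < ?n" "g v < ?n" and nth: "p ! g u = u" "p ! g v = v"
      using nth_g in_arcsD1[OF uv] in_arcsD2[OF uv] by blast+
    have "g u \<noteq> g v" using nth adj_neq[OF uv] by metis
    then have "g v = Suc (g u) \<or> g u = Suc (g v)"
      using vpath_adj_nth[OF p(1), of "g u" "g v"] vpath_adj_nth[OF p(1), of "g v" "g u"]
        lt nth uv adj_symD[OF uv] by (cases "g u < g v") simp_all
    then show "e \<in> parcs (path_graph ?n)" using e lt unfolding path_graph_def by simp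
  qed
  let ?hom = "\<lparr>iso_verts = g, iso_arcs = (\<lambda>(u, v). (g u, g v)), iso_head = snd, iso_tail = fst\<rparr>"
  have "inj_on g V" using bij_g by (rule bij_betw_imp_inj_on)
  then have "inj_on (\<lambda>(u, v). (g u, g v)) (parcs T)"
    using in_arcsD1 in_arcsD2 by (intro inj_onI) (auto dest: inj_onD)
  then have "digraph_isomorphism ?hom"
    using \<open>inj_on g V\<close> wf_digraph by (auto simp: digraph_isomorphism_def)
  moreover have "with_proj (path_graph ?n) = app_iso ?hom (with_proj T)"
    using bij_betw_imp_surj_on[OF bij_g] parcs
    by (simp add: app_iso_def with_proj_def path_graph_def)
  ultimately show ?thesis unfolding digraph_iso_def by blast
qed

text \<open>The preimages of \<open>0, ..., k - 1\<close>, read in this order, form the spanning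
  path.\<close>

lemma digraph_iso_path_graphD:
  assumes "digraph_iso (with_proj T) (with_proj (path_graph k))" "0 < k"
  shows "\<exists>p. vpath p (with_proj T) \<and> set p = V \<and> length p = k"
proof -
  obtain f where f: "digraph_isomorphism f" and H: "with_proj (path_graph k) = app_iso f (with_proj T)"
    using assms(1) unfolding digraph_iso_def by blast
  define g where "g = iso_verts f"
  have "verts (with_proj (path_graph k)) = g ` V" unfolding H g_def by simp
  then have img: "g ` V = {..<k}" by (simp add: path_graph_def)
  \<comment> \<open>Equality of the two digraphs includes their tail and head functions; this links
    the otherwise arbitrary arc map of \<open>f\<close> to its vertex map.\<close>
  have "tail (with_proj (path_graph k)) = iso_tail f" "head (with_proj (path_graph k)) = iso_head f"
    unfolding H by simp_all
  then have ends: "iso_tail f = fst" "iso_head f = snd" by simp_all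
  have inj: "inj_on g V" using f unfolding digraph_isomorphism_def g_def by simp
  then have bij: "bij_betw g V {..<k}" using img unfolding bij_betw_def by simp
  define h where "h = the_inv_into V g"
  have bij_h: "bij_betw h {..<k} V" unfolding h_def by (rule bij_betw_the_inv_into[OF bij])
  have hg: "h (g v) = v" if "v \<in> V" for v
    unfolding h_def using the_inv_into_f_f[OF inj that] .
  have adj_h: "adj (h i) (h (Suc i))" if "Suc i < k" for i
  proof -
    have "(i, Suc i) \<in> arcs (with_proj (path_graph k))" using that by (simp add: path_graph_def)
    then obtain e where e: "e \<in> parcs T" "(i, Suc i) = iso_arcs f e" unfolding H by auto
    then have "g (fst e) = i" "g (snd e) = Suc i"
      using f ends e(2)[symmetric] unfolding digraph_isomorphism_def g_def by auto
    then have "h i = fst e" "h (Suc i) = snd e"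
      using hg arc_fst_in_verts[OF e(1)] arc_snd_in_verts[OF e(1)] by metis+
    then show ?thesis using e(1) by simp
  qed
  have "set (map h [0..<k]) = V" using bij_betw_imp_surj_on[OF bij_h] by (simp add: atLeast0LessThan)
  moreover have "distinct (map h [0..<k])"
    using bij_betw_imp_inj_on[OF bij_h] by (simp add: distinct_map atLeast0LessThan)
  ultimately have "vpath (map h [0..<k]) (with_proj T)"
    using adj_h \<open>0 < k\<close> unfolding vpath_nth by simp
  then show ?thesis using \<open>set (map h [0..<k]) = V\<close> by (intro exI[of _ "map h [0..<k]"]) simp
qed

section \<open>Leaves as pendant vertices\<close>

lemma leaf_iff: "leaf T x \<longleftrightarrow> (\<exists>s. pendant x s)"
proof -
  have "out_degree (with_proj T) x = card {e \<in> parcs T. fst e = x}"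
    by (simp add: out_degree_def out_arcs_def)
  also have "{e \<in> parcs T. fst e = x} = Pair x ` {u. adj x u}" by force
  also have "card (Pair x ` {u. adj x u}) = card {u. adj x u}" by (intro card_image inj_onI) simp
  finally have deg: "out_degree (with_proj T) x = card {u. adj x u}" .
  have "card {u. adj x u} = 1 \<longleftrightarrow> (\<exists>s. {u. adj x u} = {s})" by (simp add: card_1_singleton_iff)
  also have "\<dots> \<longleftrightarrow> (\<exists>s. pendant x s)" unfolding pendant_def by (simp add: set_eq_iff)
  finally show ?thesis using deg pendant_in_verts(1) unfolding leaf_def by auto
qed

lemma not_leafI:
  assumes "adj a b" "adj a b'" "b \<noteq> b'"
  shows "\<not> leaf T a"
proof
  assume "leaf T a"
  then obtain t where "pendant a t" unfolding leaf_iff by blast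
  then show False using assms pendant_adj[of a t b] pendant_adj[of a t b'] by simp
qed

section \<open>Orders five and six\<close>

text \<open>One vertex \<open>v\<close> remains besides the leaves and supports. If the supports are
  adjacent, \<open>v\<close> hangs on one of them and gives a double star; otherwise
  \<open>v\<close> joins them and gives a path.\<close>

lemma order_five_cases:
  assumes P: "two_pendants l\<^sub>1 s\<^sub>1 l\<^sub>2 s\<^sub>2" and "card V = 5"
  shows "digraph_iso (with_proj T) (with_proj (path_graph 5)) \<or> double_star 2 1 T"
proof -
  obtain v where Vv: "V - {l\<^sub>1, s\<^sub>1, l\<^sub>2, s\<^sub>2} = {v}"
    using card_outside_two_pendants[OF P] assms(2) card_1_singletonE[of "V - {l\<^sub>1, s\<^sub>1, l\<^sub>2, s\<^sub>2}"] by auto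
  have star: "double_star 2 1 T"
    if P: "two_pendants l s l' s'" and Vv: "V - {l, s, l', s'} = {v}" and ss: "adj s s'" and vs: "adj v s"
    for l s l' s'
  proof -
    have p: "pendant l s" "pendant l' s'" and d: "distinct [l, s, l', s']"
      using P unfolding two_pendants_def by blast+
    have V: "V = {l, s, l', s', v}" using two_pendants_verts[OF P] Vv by blast
    have vQ: "v \<noteq> l" "v \<noteq> s" "v \<noteq> l'" "v \<noteq> s'" using Vv by auto
    have vs': "\<not> adj v s'" using no_triangle[of v s s'] ss vs adj_sym[of v s'] by blast
    have pv: "pendant v s"
      unfolding pendant_def
    proof (intro allI iffI)
      fix u assume "adj v u"
      moreover from this have "u \<in> V" by (rule in_arcsD2)
      ultimately show "u = s" using vQ vs' pendant_adj'[OF p(1)] pendant_adj'[OF p(2)] unfolding V by auto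
    qed (use vs in simp)
    have "adj s l" "adj s' l'" "l \<noteq> s'" "l' \<noteq> s"
      using pendant_adj'[OF p(1), of s] pendant_adj'[OF p(2), of s'] d by auto
    then have "\<not> leaf T s" "\<not> leaf T s'"
      using not_leafI[of s l s'] not_leafI[of s' l' s] ss adj_symD[OF ss] by simp_all
    moreover have "leaf T l" "leaf T l'" "leaf T v" unfolding leaf_iff using p pv by blast+
    moreover have "x \<in> V" if "leaf T x" for x using that unfolding leaf_def by blast
    ultimately have leaves: "leaf T x \<longleftrightarrow> x \<in> {l, l', v}" for x
      unfolding V by blast
    have inner: "{x \<in> V. \<not> leaf T x} = {s, s'}" unfolding leaves V using vQ d by auto
    have "{x. leaf T x \<and> adj s x} = {l, v}"
      using pendant_adj'[OF p(1)] pendant_adj'[OF p(2)] pendant_adj'[OF pv] d unfolding leaves by auto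
    then have "card {x. leaf T x \<and> adj s x} = 2" using vQ by simp
    moreover have "{x. leaf T x \<and> adj s' x} = {l'}"
      using pendant_adj'[OF p(1)] pendant_adj'[OF p(2)] pendant_adj'[OF pv] d unfolding leaves by auto
    then have "card {x. leaf T x \<and> adj s' x} = 1" by simp
    ultimately show ?thesis
      unfolding double_star_def using undirected_tree inner ss d
      by (intro conjI exI[of _ s] exI[of _ s']) simp_all
  qed
  \<comment> \<open>Connectedness supplies an edge leaving \<open>{l, s}\<close>. It starts at
    \<open>s\<close>, and it cannot end at \<open>l'\<close> or \<open>s'\<close>, which leaves
    \<open>v\<close>.\<close>
  have attached: "adj s v"
    if P: "two_pendants l s l' s'" and Vv: "V - {l, s, l', s'} = {v}" and ss: "\<not> adj s s'"
    for l s l' s'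
  proof -
    have p: "pendant l s" "pendant l' s'" and d: "distinct [l, s, l', s']"
      using P unfolding two_pendants_def by blast+
    have "{l, s} \<subseteq> V" "{l, s} \<noteq> V" using two_pendants_verts[OF P] d by auto
    then obtain u w where uw: "u \<in> {l, s}" "w \<in> V - {l, s}" "adj u w"
      using edge_leaving[of "{l, s}"] by blast
    have "u \<noteq> l" using uw(2,3) pendant_adj[OF p(1), of w] by auto
    then have sw: "adj s w" using uw by simp
    moreover have "w \<noteq> l'" using sw pendant_adj'[OF p(2), of s] d by auto
    moreover have "w \<noteq> s'" using sw ss by blast
    ultimately have "w \<in> V - {l, s, l', s'}" using uw(2) by blast
    then show ?thesis using Vv sw by simp
  qed
  have p: "pendant l\<^sub>1 s\<^sub>1" "pendant l\<^sub>2 s\<^sub>2" and d: "distinct [l\<^sub>1, s\<^sub>1, l\<^sub>2, s\<^sub>2]"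
    using P unfolding two_pendants_def by blast+
  have V: "V = {l\<^sub>1, s\<^sub>1, l\<^sub>2, s\<^sub>2, v}" using two_pendants_verts[OF P] Vv by blast
  have vQ: "v \<noteq> l\<^sub>1" "v \<noteq> s\<^sub>1" "v \<noteq> l\<^sub>2" "v \<noteq> s\<^sub>2" using Vv by auto
  note not_leaf = pendant_adj'[OF p(1)] pendant_adj'[OF p(2)]
  show ?thesis
  proof (cases "adj s\<^sub>1 s\<^sub>2")
    case True
    have "\<exists>u\<in>{v}. \<exists>w\<in>V - {v}. adj u w" using V vQ by (intro edge_leaving) auto
    then have "adj v s\<^sub>1 \<or> adj v s\<^sub>2" using vQ not_leaf unfolding V by auto
    moreover have "V - {l\<^sub>2, s\<^sub>2, l\<^sub>1, s\<^sub>1} = {v}" using Vv by blast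
    ultimately show ?thesis
      using star[OF P Vv True] star[OF two_pendants_commute[OF P] _ adj_symD[OF True]] by blast
  next
    case False
    have 1: "adj s\<^sub>1 v" by (rule attached[OF P Vv False])
    have "V - {l\<^sub>2, s\<^sub>2, l\<^sub>1, s\<^sub>1} = {v}" using Vv by blast
    moreover have "\<not> adj s\<^sub>2 s\<^sub>1" using False adj_sym[of s\<^sub>2 s\<^sub>1] by simp
    ultimately have 2: "adj s\<^sub>2 v" by (rule attached[OF two_pendants_commute[OF P]])
    have set: "set [l\<^sub>1, s\<^sub>1, v, s\<^sub>2, l\<^sub>2] = V" unfolding V by auto
    have arcs: "set (vwalk_arcs [l\<^sub>1, s\<^sub>1, v, s\<^sub>2, l\<^sub>2]) \<subseteq> parcs T"
      using 1 adj_symD[OF 2] pendant_adj[OF p(1)] pendant_adj'[OF p(2)] by simp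
    have dist: "distinct [l\<^sub>1, s\<^sub>1, v, s\<^sub>2, l\<^sub>2]" using d vQ by auto
    have path: "vpath [l\<^sub>1, s\<^sub>1, v, s\<^sub>2, l\<^sub>2] (with_proj T)"
      by (rule spanning_vpathI[OF _ dist set arcs]) simp
    have "length [l\<^sub>1, s\<^sub>1, v, s\<^sub>2, l\<^sub>2] = 5" by simp
    from digraph_iso_path_graphI[OF path set, unfolded this] show ?thesis by (rule disjI1)
  qed
qed

text \<open>The two remaining vertices have degree at least two, and their neighbours are supports
  or each other. Excluding triangles and squares leaves only a path between the supports through
  both of them.\<close>

lemma order_six_case:
  assumes P: "two_pendants l\<^sub>1 s\<^sub>1 l\<^sub>2 s\<^sub>2" and card: "card V = 6"
    and pair: "coalition_pair x y" "x \<in> V" "y \<in> V"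
  shows "digraph_iso (with_proj T) (with_proj (path_graph 6))"
proof -
  let ?Q = "{l\<^sub>1, s\<^sub>1, l\<^sub>2, s\<^sub>2}"
  have p: "pendant l\<^sub>1 s\<^sub>1" "pendant l\<^sub>2 s\<^sub>2" and d: "distinct [l\<^sub>1, s\<^sub>1, l\<^sub>2, s\<^sub>2]"
    using P unfolding two_pendants_def by blast+
  note not_leaf = pendant_adj'[OF p(1)] pendant_adj'[OF p(2)]
  have xy: "{x, y} = V - ?Q \<or> {x, y} = {l\<^sub>1, l\<^sub>2}"
    by (rule coalition_pair_card(2)[OF P pair card])
  \<comment> \<open>A third leaf could replace \<open>l\<^sub>1\<close> if its support is
    \<open>s\<^sub>1\<close>, and \<open>l\<^sub>2\<close> otherwise. The two possible pairs for the
    new choice of leaves differ from both for the old one.\<close>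
  have no_pendant: "\<not> pendant l s" if l: "l \<in> V - ?Q" for l s
  proof
    assume pl: "pendant l s"
    have lv: "l \<notin> ?Q" "l \<in> V" using l by blast+
    have "adj l s" by (simp add: pendant_adj[OF pl])
    then have nl: "s \<noteq> l\<^sub>1" "s \<noteq> l\<^sub>2" "s \<noteq> l"
      using not_leaf(1)[of l] not_leaf(2)[of l] lv adj_neq by auto
    have V: "?Q \<subseteq> V" by (rule two_pendants_verts[OF P])
    show False
    proof (cases "s = s\<^sub>1")
      case True
      then have "two_pendants l s\<^sub>1 l\<^sub>2 s\<^sub>2" using p d lv pl unfolding two_pendants_def by auto
      from coalition_pair_card(2)[OF this pair card]
      show False using xy d lv V by (auto simp: set_eq_iff)
    next
      case False
      then have "two_pendants l\<^sub>1 s\<^sub>1 l s" using p d lv nl pl unfolding two_pendants_def by auto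
      from coalition_pair_card(2)[OF this pair card]
      show False using xy d lv V by (auto simp: set_eq_iff)
    qed
  qed
  have "card (V - ?Q) = 2" using card_outside_two_pendants[OF P] card by simp
  then obtain v w where vw: "V - ?Q = {v, w}" "v \<noteq> w" unfolding card_2_iff by blast
  then have V: "V = {l\<^sub>1, s\<^sub>1, l\<^sub>2, s\<^sub>2, v, w}" using two_pendants_verts[OF P] by blast
  have Q: "v \<noteq> l\<^sub>1" "v \<noteq> s\<^sub>1" "v \<noteq> l\<^sub>2" "v \<noteq> s\<^sub>2" "w \<noteq> l\<^sub>1" "w \<noteq> s\<^sub>1" "w \<noteq> l\<^sub>2" "w \<noteq> s\<^sub>2"
    using vw(1) by blast+
  have degree: "\<not> (\<forall>u. adj a u \<longrightarrow> u = b)" if "a \<in> {v, w}" for a b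
  proof
    assume only: "\<forall>u. adj a u \<longrightarrow> u = b"
    have "\<exists>u\<in>{a}. \<exists>z\<in>V - {a}. adj u z" using that V d by (intro edge_leaving) auto
    then have "pendant a b" using only unfolding pendant_def by blast
    then show False using no_pendant vw(1) that by blast
  qed
  have nbr: "u \<in> {s\<^sub>1, s\<^sub>2, v, w} - {a}" if "adj a u" "a \<in> {v, w}" for a u
  proof -
    have "u \<in> V" "u \<noteq> a" using in_arcsD2[OF that(1)] adj_neq[OF that(1)] by simp_all
    moreover have "u \<noteq> l\<^sub>1" "u \<noteq> l\<^sub>2" using that not_leaf(1)[of a] not_leaf(2)[of a] Q by auto
    ultimately show ?thesis unfolding V by blast
  qed
  have two_nbrs: "adj a s\<^sub>1 \<and> adj a s\<^sub>2 \<or> adj a s\<^sub>1 \<and> adj a b \<or> adj a s\<^sub>2 \<and> adj a b"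
    if "{a, b} = {v, w}" for a b
  proof -
    have a: "a \<in> {v, w}" using that by blast
    have other: "\<exists>u. adj a u \<and> u \<noteq> c" for c using degree[OF a, of c] by simp
    have "u = s\<^sub>1 \<or> u = s\<^sub>2 \<or> u = b" if "adj a u" for u
      using nbr[OF that a] \<open>{a, b} = {v, w}\<close> by blast
    then show ?thesis using other[of s\<^sub>1] other[of s\<^sub>2] other[of b] by blast
  qed
  \<comment> \<open>\<open>refl\<close> instantiates \<open>a, b\<close> with \<open>v, w\<close>,
    and \<open>insert_commute\<close> with \<open>w, v\<close>.\<close>
  note dv = two_nbrs[OF refl] and dw = two_nbrs[OF insert_commute]
  have tri: "\<not> (adj v a \<and> adj w a \<and> adj v w)" for a
    using no_triangle[of v w a] adj_sym[of a v] by blast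
  have sq: "\<not> (adj v s\<^sub>1 \<and> adj v s\<^sub>2 \<and> adj w s\<^sub>1 \<and> adj w s\<^sub>2)"
  proof
    assume "adj v s\<^sub>1 \<and> adj v s\<^sub>2 \<and> adj w s\<^sub>1 \<and> adj w s\<^sub>2"
    moreover from this have "adj s\<^sub>1 w" "adj s\<^sub>2 v" by (blast intro: adj_symD)+
    moreover have "s\<^sub>1 \<noteq> s\<^sub>2" using d by simp
    ultimately show False using no_square[of v s\<^sub>1 w s\<^sub>2] vw(2) by blast
  qed
  have path: "digraph_iso (with_proj T) (with_proj (path_graph 6))"
    if "adj a s\<^sub>1" "adj a b" "adj b s\<^sub>2" "{a, b} = {v, w}" for a b
  proof -
    have ab: "distinct [l\<^sub>1, s\<^sub>1, a, b, s\<^sub>2, l\<^sub>2]" using that(4) Q d vw(2) by auto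
    have set: "set [l\<^sub>1, s\<^sub>1, a, b, s\<^sub>2, l\<^sub>2] = V" using that(4) V by auto
    have arcs: "set (vwalk_arcs [l\<^sub>1, s\<^sub>1, a, b, s\<^sub>2, l\<^sub>2]) \<subseteq> parcs T"
      using adj_symD[OF that(1)] that(2,3) pendant_adj[OF p(1)] pendant_adj'[OF p(2)] by simp
    have path: "vpath [l\<^sub>1, s\<^sub>1, a, b, s\<^sub>2, l\<^sub>2] (with_proj T)"
      by (rule spanning_vpathI[OF _ ab set arcs]) simp
    have "length [l\<^sub>1, s\<^sub>1, a, b, s\<^sub>2, l\<^sub>2] = 6" by simp
    from digraph_iso_path_graphI[OF path set, unfolded this] show ?thesis .
  qed
  \<comment> \<open>If \<open>v\<close> and \<open>w\<close> were not adjacent, both would be joined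
    to both supports, a square. As they are adjacent, a common support would give a
    triangle.\<close>
  have "adj v w \<and> (adj v s\<^sub>1 \<and> adj w s\<^sub>2 \<or> adj v s\<^sub>2 \<and> adj w s\<^sub>1)"
    using dv dw tri[of s\<^sub>1] tri[of s\<^sub>2] sq adj_sym[of w v] by blast
  then show ?thesis
    using path[OF _ _ _ refl] path[OF _ _ _ insert_commute] adj_sym[of v w] by blast
qed

section \<open>Coalition numbers of the exceptional trees\<close>

text \<open>The two leaves form the pair. It is the partner of every outside vertex, while the two
  supports are partners of each other. An outside vertex also rules out the partition into
  singletons.\<close>

lemma coalition_number_of_two_pendants:
  assumes P: "two_pendants l\<^sub>1 s\<^sub>1 l\<^sub>2 s\<^sub>2"
    and outside: "V - {l\<^sub>1, s\<^sub>1, l\<^sub>2, s\<^sub>2} \<noteq> {}"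
    and supports: "dominating {s\<^sub>1, s\<^sub>2}"
    and leaves: "\<And>v. v \<in> V - {l\<^sub>1, s\<^sub>1, l\<^sub>2, s\<^sub>2} \<Longrightarrow> dominating {v, l\<^sub>1, l\<^sub>2}"
  shows "coalition_number T = card V - 1"
proof -
  let ?Q = "{l\<^sub>1, s\<^sub>1, l\<^sub>2, s\<^sub>2}"
  let ?\<Psi> = "insert {l\<^sub>1, l\<^sub>2} (singletons (V - {l\<^sub>1, l\<^sub>2}))"
  have p: "pendant l\<^sub>1 s\<^sub>1" "pendant l\<^sub>2 s\<^sub>2" and d: "distinct [l\<^sub>1, s\<^sub>1, l\<^sub>2, s\<^sub>2]"
    using P unfolding two_pendants_def by blast+
  have V: "l\<^sub>1 \<in> V" "s\<^sub>1 \<in> V" "l\<^sub>2 \<in> V" "s\<^sub>2 \<in> V" using two_pendants_verts[OF P] by blast+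
  obtain v where v: "v \<in> V - ?Q" using outside by blast
  have leaf_pair: "\<not> dominating {l\<^sub>1, l\<^sub>2}"
    using dominatingD[of "{l\<^sub>1, l\<^sub>2}" v] v pendant_adj'[OF p(1)] pendant_adj'[OF p(2)] by auto
  have single: "\<not> dominating {u}" for u
    using dominating_pendant[OF _ p(1), of "{u}"] dominating_pendant[OF _ p(2), of "{u}"] d by auto
  have outer: "coalition T {u} {l\<^sub>1, l\<^sub>2}" "coalition T {l\<^sub>1, l\<^sub>2} {u}" if "u \<in> V - ?Q" for u
    using that V leaf_pair single leaves[OF that] by (auto simp: coalition_def insert_commute)
  have inner: "coalition T {s\<^sub>1} {s\<^sub>2}" "coalition T {s\<^sub>2} {s\<^sub>1}"
    using V d single supports by (auto intro!: coalition_singletonI simp: insert_commute)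
  have mem: "{u} \<in> ?\<Psi>" if "u \<in> V - {l\<^sub>1, l\<^sub>2}" for u using that by (simp add: singletons_def)
  have "coalition_partition T ?\<Psi>"
    unfolding coalition_partition_def
  proof (intro conjI ballI disjI2)
    show "partition_on V ?\<Psi>" using V(1,3) by (rule partition_on_pair_singletons)
    fix A assume "A \<in> ?\<Psi>"
    then consider "A = {l\<^sub>1, l\<^sub>2}" | "A = {s\<^sub>1}" | "A = {s\<^sub>2}" | u where "A = {u}" "u \<in> V - ?Q"
      unfolding singletons_def by auto
    note A = this
    show "\<not> dominating A" using A leaf_pair single by cases simp_all
    show "\<exists>B\<in>?\<Psi>. coalition T A B"
      using A
    proof cases
      case 1
      moreover have "{v} \<in> ?\<Psi>" by (rule mem) (use v in simp)
      ultimately show ?thesis using outer(2)[OF v] by blast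
    next
      case 2
      moreover have "{s\<^sub>2} \<in> ?\<Psi>" by (rule mem) (use V d in auto)
      ultimately show ?thesis using inner(1) by blast
    next
      case 3
      moreover have "{s\<^sub>1} \<in> ?\<Psi>" by (rule mem) (use V d in auto)
      ultimately show ?thesis using inner(2) by blast
    next
      case (4 u)
      then have "coalition T A {l\<^sub>1, l\<^sub>2}" using outer(1) by simp
      then show ?thesis by blast
    qed
  qed
  moreover have "card ?\<Psi> = card V - 1"
    using card_pair_singletons[OF pair_finite_verts V(1,3)] d by simp
  ultimately show ?thesis
    by (rule coalition_number_eq_pred[OF pair_finite_verts singletons_not_coalition_partition[OF P v]])
qed

text \<open>All leaves share the support \<open>c\<close>, so this case is computed directly:
  \<open>{c}\<close> dominates on its own, and \<open>{a, b}\<close> and \<open>{d}\<close> form a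
  coalition. In the partition into singletons \<open>{a}\<close> has no partner, since two leaves
  miss the third and \<open>{c}\<close> dominates.\<close>

lemma coalition_number_star:
  assumes "complete_bipartite_digraph 1 3 (with_proj T)"
  shows "coalition_number T = card V - 1"
proof -
  obtain U W where UW: "V = U \<union> W" "U \<inter> W = {}" "card U = 1" "card W = 3"
    and arcs: "parcs T = U \<times> W \<union> W \<times> U"
    using assms unfolding complete_bipartite_digraph_pair_def by blast
  obtain c where U: "U = {c}" using UW(3) by (rule card_1_singletonE)
  obtain a b d where W: "W = {a, b, d}" "a \<noteq> b" "b \<noteq> d" "a \<noteq> d"
    using UW(4) unfolding card_3_iff by blast
  have V: "V = {c, a, b, d}" and c: "c \<noteq> a" "c \<noteq> b" "c \<noteq> d" using UW(1,2) U W(1) by auto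
  have adj: "adj u v \<longleftrightarrow> u = c \<and> v \<in> {a, b, d} \<or> v = c \<and> u \<in> {a, b, d}" for u v
    unfolding arcs U W(1) by auto
  let ?\<Psi> = "insert {a, b} (singletons (V - {a, b}))"
  have \<Psi>: "?\<Psi> = {{a, b}, {c}, {d}}" unfolding V singletons_def using W c by auto
  have pend: "pendant a c" "pendant b c" "pendant d c"
    unfolding pendant_def adj using c by auto
  have dom: "dominating {c}" "dominating {a, b, d}"
    unfolding dominating_set_def V by (auto simp: adj)
  have not_dom: "\<not> dominating {a}" "\<not> dominating {d}" "\<not> dominating {a, b}"
    using dominating_pendant[OF _ pend(2), of "{a}"] dominating_pendant[OF _ pend(2), of "{d}"]
      dominating_pendant[OF _ pend(3), of "{a, b}"] W(2-) c by auto
  have not_dom': "\<not> dominating {a, w}" if "w \<noteq> c" for w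
    using dominating_pendant[OF _ pend(2), of "{a, w}"] dominating_pendant[OF _ pend(3), of "{a, w}"]
      W(2-) c that by auto
  have co: "coalition T {a, b} {d}" "coalition T {d} {a, b}"
    using dom(2) not_dom(2,3) W(2-) unfolding coalition_def V by (auto simp: insert_commute)
  have "partition_on V ?\<Psi>" by (rule partition_on_pair_singletons) (use V in simp_all)
  then have part: "coalition_partition T ?\<Psi>"
    unfolding coalition_partition_def \<Psi> using dom(1) not_dom co by auto
  have card: "card ?\<Psi> = card V - 1"
    by (rule card_pair_singletons[OF pair_finite_verts]) (use V W in simp_all)
  have no_singletons: "\<not> coalition_partition T (singletons V)"
  proof
    assume "coalition_partition T (singletons V)"
    moreover have "{a} \<in> singletons V" unfolding V singletons_def by simp
    ultimately obtain B where "B \<in> singletons V" "coalition T {a} B"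
      using not_dom(1) unfolding coalition_partition_def by blast
    then obtain w where "\<not> dominating {w}" "dominating {a, w}"
      unfolding singletons_def coalition_def by auto
    moreover from this have "w \<noteq> c" using dom(1) by auto
    ultimately show False using not_dom'[of w] by simp
  qed
  show ?thesis by (rule coalition_number_eq_pred[OF pair_finite_verts no_singletons part card])
qed

text \<open>No path has more vertices than a spanning one, so its two ends are pendant.\<close>

lemma spanning_path_pendants:
  assumes p: "vpath (l\<^sub>1 # s\<^sub>1 # r @ [s\<^sub>2, l\<^sub>2]) (with_proj T)" "set (l\<^sub>1 # s\<^sub>1 # r @ [s\<^sub>2, l\<^sub>2]) = V"
  shows "two_pendants l\<^sub>1 s\<^sub>1 l\<^sub>2 s\<^sub>2"
proof -
  have max: "length q \<le> length (l\<^sub>1 # s\<^sub>1 # r @ [s\<^sub>2, l\<^sub>2])" if "vpath q (with_proj T)" for q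
  proof -
    have "length q = card (set q)" "set q \<subseteq> V"
      using that distinct_card[of q] unfolding vpath_nth by auto
    then have "length q \<le> card V" using card_mono[OF pair_finite_verts] by metis
    then show ?thesis using card_length[of "l\<^sub>1 # s\<^sub>1 # r @ [s\<^sub>2, l\<^sub>2]"] p(2) by simp
  qed
  have "pendant l\<^sub>1 s\<^sub>1" by (rule pendant_of_maximal_path[OF p(1) max])
  moreover have rev: "vpath (l\<^sub>2 # s\<^sub>2 # rev r @ [s\<^sub>1, l\<^sub>1]) (with_proj T)" using vpath_rev[OF p(1)] by simp
  have "pendant l\<^sub>2 s\<^sub>2" by (rule pendant_of_maximal_path[OF rev]) (use max in simp)
  moreover have "distinct [l\<^sub>1, s\<^sub>1, l\<^sub>2, s\<^sub>2]" using p(1) unfolding vpath_nth by auto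
  ultimately show ?thesis unfolding two_pendants_def by blast
qed

lemma coalition_number_path_five:
  assumes "digraph_iso (with_proj T) (with_proj (path_graph 5))"
  shows "coalition_number T = card V - 1"
proof -
  obtain p where p: "vpath p (with_proj T)" "set p = V" "length p = 5"
    using digraph_iso_path_graphD[OF assms] by auto
  then obtain a b c d e where p_eq: "p = [a, b, c, d, e]"
    by (auto simp: length_Suc_conv numeral_eq_Suc)
  have P: "two_pendants a b e d"
    using spanning_path_pendants[of a b "[c]" d e] p unfolding p_eq by simp
  have V: "V = {a, b, c, d, e}" using p(2) unfolding p_eq by simp
  have adj: "adj a b" "adj b c" "adj c d" "adj d e" and dist: "distinct [a, b, c, d, e]"
    using p(1) unfolding p_eq vpath_def vwalk_def by simp_all
  note adj = adj adj[THEN adj_symD]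
  show ?thesis
    by (rule coalition_number_of_two_pendants[OF P])
       (use adj dist in \<open>auto simp: V dominating_set_def\<close>)
qed

lemma coalition_number_path_six:
  assumes "digraph_iso (with_proj T) (with_proj (path_graph 6))"
  shows "coalition_number T = card V - 1"
proof -
  obtain p where p: "vpath p (with_proj T)" "set p = V" "length p = 6"
    using digraph_iso_path_graphD[OF assms] by auto
  then obtain a b c d e f where p_eq: "p = [a, b, c, d, e, f]"
    by (auto simp: length_Suc_conv numeral_eq_Suc)
  have P: "two_pendants a b f e"
    using spanning_path_pendants[of a b "[c, d]" e f] p unfolding p_eq by simp
  have V: "V = {a, b, c, d, e, f}" using p(2) unfolding p_eq by simp
  have adj: "adj a b" "adj b c" "adj c d" "adj d e" "adj e f" and dist: "distinct [a, b, c, d, e, f]"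
    using p(1) unfolding p_eq vpath_def vwalk_def by simp_all
  note adj = adj adj[THEN adj_symD]
  show ?thesis
    by (rule coalition_number_of_two_pendants[OF P])
       (use adj dist in \<open>auto simp: V dominating_set_def\<close>)
qed

text \<open>The vertices are the two centres \<open>u\<close>, \<open>v\<close>, the leaves
  \<open>a\<close>, \<open>b\<close> at \<open>u\<close> and the leaf \<open>d\<close> at
  \<open>v\<close>. The pair is \<open>{a, d}\<close>, with \<open>b\<close> as the only outside
  vertex.\<close>

lemma coalition_number_double_star:
  assumes "double_star 2 1 T"
  shows "coalition_number T = card V - 1"
proof -
  obtain u v where uv: "u \<noteq> v" "adj u v" and inner: "{x \<in> V. \<not> leaf T x} = {u, v}"
    and cards: "card {x. leaf T x \<and> adj u x} = 2" "card {x. leaf T x \<and> adj v x} = 1"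
    using assms unfolding double_star_def by blast
  obtain a b where ab: "{x. leaf T x \<and> adj u x} = {a, b}" "a \<noteq> b"
    using cards(1) unfolding card_2_iff by blast
  obtain d where d: "{x. leaf T x \<and> adj v x} = {d}"
    using cards(2) by (rule card_1_singletonE)
  have not_leaf: "\<not> leaf T u" "\<not> leaf T v" and uvV: "u \<in> V" "v \<in> V" using inner by blast+
  have pendant_at: "pendant x z" if "leaf T x" "adj z x" for x z
  proof -
    obtain s where "pendant x s" using \<open>leaf T x\<close> unfolding leaf_iff by blast
    then show ?thesis using pendant_adj'[of x s z] \<open>adj z x\<close> by simp
  qed
  \<comment> \<open>A leaf attached to neither centre would be adjacent to another leaf, and these
    two alone would form a component that misses \<open>u\<close>.\<close>
  have at_inner: "adj u x \<or> adj v x" if x: "leaf T x" for x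
  proof (rule ccontr)
    assume away: "\<not> (adj u x \<or> adj v x)"
    obtain s where s: "pendant x s" using x unfolding leaf_iff by blast
    then have sx: "adj s x" by (simp add: pendant_adj')
    then have "s \<noteq> u" "s \<noteq> v" "s \<in> V" using away in_arcsD1 by blast+
    then have "leaf T s" using inner by blast
    then obtain t where "pendant s t" unfolding leaf_iff by blast
    then have "pendant s x" using sx pendant_adj[of s t x] by simp
    moreover have "\<exists>y\<in>{x, s}. \<exists>z\<in>V - {x, s}. adj y z"
      using x not_leaf uvV(1) \<open>s \<noteq> u\<close> pendant_in_verts[OF s] by (intro edge_leaving) auto
    ultimately show False using pendant_adj[OF s] pendant_adj[of s x] by auto
  qed
  have leaves: "leaf T a" "leaf T b" "leaf T d" and adj: "adj u a" "adj u b" "adj v d"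
    using ab(1) d by blast+
  then have pend: "pendant a u" "pendant b u" "pendant d v" using pendant_at by blast+
  have V: "V = {u, v, a, b, d}"
  proof (intro equalityI subsetI)
    fix x assume x: "x \<in> V"
    show "x \<in> {u, v, a, b, d}"
    proof (cases "leaf T x")
      case True
      then show ?thesis using at_inner[OF True] ab(1) d by blast
    next
      case False
      then show ?thesis using x inner by blast
    qed
  qed (use uvV pend pendant_in_verts in blast)
  have neq: "a \<noteq> u" "a \<noteq> v" "b \<noteq> u" "b \<noteq> v" "d \<noteq> u" "d \<noteq> v"
    using leaves not_leaf by auto
  have neq_d: "a \<noteq> d" "b \<noteq> d"
    using pendant_adj[OF pend(1)] pendant_adj[OF pend(2)] pendant_adj[OF pend(3), of v] uv(1) by auto
  have P: "two_pendants a u d v"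
    unfolding two_pendants_def using pend neq neq_d uv(1) by simp
  note adj = adj uv(2) adj[THEN adj_symD] adj_symD[OF uv(2)]
  show ?thesis
    by (rule coalition_number_of_two_pendants[OF P])
       (use adj uv(1) neq neq_d ab(2) in \<open>auto simp: V dominating_set_def\<close>)
qed

section \<open>The equivalence for a fixed tree\<close>

lemma coalition_number_eq_pred_iff:
  "coalition_number T = card V - 1 \<longleftrightarrow>
    complete_bipartite_digraph 1 3 (with_proj T)
    \<or> digraph_iso (with_proj T) (with_proj (path_graph 5))
    \<or> digraph_iso (with_proj T) (with_proj (path_graph 6))
    \<or> double_star 2 1 T" (is "_ \<longleftrightarrow> ?R")
proof
  assume number: "coalition_number T = card V - 1"
  show ?R
  proof (cases "no_universal_vertex")
    case False
    then obtain c where "c \<in> V" "\<And>v. v \<in> V - {c} \<Longrightarrow> adj c v"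
      unfolding no_universal_vertex_def by blast
    then show ?thesis using star_of_universal_vertex number by blast
  next
    case True
    obtain l\<^sub>1 s\<^sub>1 l\<^sub>2 s\<^sub>2 where P: "two_pendants l\<^sub>1 s\<^sub>1 l\<^sub>2 s\<^sub>2"
      using exists_two_pendants[OF True] unfolding two_pendants_def by blast
    have "4 \<le> card V" using card_outside_two_pendants[OF P] by simp
    then obtain x y where xy: "x \<in> V" "y \<in> V" "x \<noteq> y"
      and part: "coalition_partition T (insert {x, y} (singletons (V - {x, y})))"
      using coalition_partition_exists[OF number] by fastforce
    have pair: "coalition_pair x y" by (rule coalition_pairI[OF part xy(3) True])
    have "card V \<noteq> 4"
      using coalition_number_order_four[OF P _ True] number by fastforce
    moreover have "card V \<le> 6" by (rule coalition_pair_card(1)[OF P pair xy(1,2)])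
    ultimately consider "card V = 5" | "card V = 6" using \<open>4 \<le> card V\<close> by linarith
    then show ?thesis
    proof cases
      case 1
      then show ?thesis using order_five_cases[OF P] by blast
    next
      case 2
      then show ?thesis using order_six_case[OF P _ pair xy(1,2)] by blast
    qed
  qed
next
  assume ?R
  then show "coalition_number T = card V - 1"
    using coalition_number_star coalition_number_path_five coalition_number_path_six
      coalition_number_double_star by blast
qed

end

theorem theorem8:
  fixes T :: "'a pair_pre_digraph"
  assumes "undirected_tree T"
  shows "coalition_number T = card (pverts T) - 1 \<longleftrightarrow>
    complete_bipartite_digraph 1 3 (with_proj T)
    \<or> digraph_iso (with_proj T) (with_proj (path_graph 5))
    \<or> digraph_iso (with_proj T) (with_proj (path_graph 6))
    \<or> double_star 2 1 T"
proof -
  interpret finite_tree T using assms by unfold_locales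
  show ?thesis by (rule coalition_number_eq_pred_iff)
qed

end
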